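(* Suppose $u(x,y)$ belongs to $L^1(\Omega)\cap L^2(\Omega)$ and $\max\{\omega\|u\|_1,\sqrt{\omega}\|u\|_2\}<2\pi/C$. Let $\mu$ be the Jost function of $u$. Then, for every $(x,y)\in\Omega$, the function $z\mapsto\mu(x,y;z)$ is holomorphic on $\mathbb{C}_\omega$.
   Context: Fix $\ell>0$ and put $\omega=\pi/\ell$. $\Omega=[-\ell,\ell]\times\mathbb{R}$; functions on $\Omega$ are complex-valued and regarded as $2\ell$-periodic in $x$; $\|\cdot\|_p$ is the norm of $L^p(\Omega)$. $\mathbb{Z}^*=\mathbb{Z}\setminus\{0\}$, $\mathbb{C}_\omega=\{z\in\mathbb{C}: 2\,\mathrm{Re}\,z\notin\omega\mathbb{Z}^*\}$. The Fourier transform in $(x,y)$ (with $z$ as a parameter) is $$\widehat f(m,\xi)=\frac{1}{2\ell}\int_{-\infty}^{\infty}\int_{-\ell}^{\ell}f(x,y)e^{-i\omega mx-i\xi y}\,dx\,dy,\qquad (m,\xi)\in\mathbb{Z}\times\mathbb{R}.$$ Put $P_z(m,\xi)=(\omega m)^2+2\omega mz+i\xi$ and $C=\frac{4\pi^2}{3\omega^2}+\frac{\pi}{\omega}\sqrt{\frac{\pi}{3}}$. Standing assumption (zero mass): $\int_{-\ell}^{\ell}u(x,y)\,dx=0$ for all $y\in\mathbb{R}$. The Jost function $\mu(x,y;z)$ of $u$ is the unique bounded solution, for $(x,y)\in\Omega$, $z\in\mathbb{C}_\omega$, of the integral equation $$\mu(x,y;z)=1+\frac{1}{2\pi}\sum_{m\in\mathbb{Z}^*}\int_{-\infty}^{\infty}\frac{\widehat{u\mu}(m,\xi;z)}{P_z(m,\xi)}e^{i\omega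 mx+i\xi y}\,d\xi,$$ which is the integral form of the boundary-value problem $(-\partial_y+\partial_x^2+2iz\partial_x)\mu+u\mu=0$, $\mu\to1$ as $|y|\to\infty$. *)

theory Defs
  imports "HOL-Complex_Analysis.Complex_Analysis"
begin

definition freq :: "real \<Rightarrow> real" where
  "freq l = pi / l"

definition Strip :: "real \<Rightarrow> (real \<times> real) set" where
  "Strip l = {-l..l} \<times> UNIV"

definition x_periodic :: "real \<Rightarrow> (real \<times> real \<Rightarrow> complex) \<Rightarrow> bool" where
  "x_periodic l f \<longleftrightarrow> (\<forall>x y. f (x + 2 * l, y) = f (x, y))"

definition in_Lp :: "real \<Rightarrow> real \<Rightarrow> (real \<times> real \<Rightarrow> complex) \<Rightarrow> bool" where
  "in_Lp l p f \<longleftrightarrow> f \<in> borel_measurable (lebesgue_on (Strip l)) \<and>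
     integrable (lebesgue_on (Strip l)) (\<lambda>q. cmod (f q) powr p)"

definition Lp_norm :: "real \<Rightarrow> real \<Rightarrow> (real \<times> real \<Rightarrow> complex) \<Rightarrow> real" where
  "Lp_norm l p f = (LINT q|lebesgue_on (Strip l). cmod (f q) powr p) powr (1 / p)"

(* The integral is required to exist on every horizontal slice and to vanish;
   the default value 0 of a divergent Bochner integral does not count. *)
definition zero_mass :: "real \<Rightarrow> (real \<times> real \<Rightarrow> complex) \<Rightarrow> bool" where
  "zero_mass l u \<longleftrightarrow> (\<forall>y. has_bochner_integral (lebesgue_on {-l..l}) (\<lambda>x. u (x, y)) 0)"

definition C_freq :: "real \<Rightarrow> complex set" where
  "C_freq l = {z. 2 * Re z \<notin> (\<lambda>m::int. freq l * of_int m) ` (UNIV - {0})}"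

definition fourier :: "real \<Rightarrow> (real \<times> real \<Rightarrow> complex) \<Rightarrow> int \<Rightarrow> real \<Rightarrow> complex" where
  "fourier l f m \<xi> = 1 / (2 * of_real l) *
     (LINT y|lebesgue. LINT x|lebesgue_on {-l..l}.
        f (x, y) * exp (- \<i> * of_real (freq l * of_int m * x) - \<i> * of_real (\<xi> * y)))"

definition P :: "real \<Rightarrow> complex \<Rightarrow> int \<Rightarrow> real \<Rightarrow> complex" where
  "P l z m \<xi> = (of_real (freq l) * of_int m)\<^sup>2
     + 2 * of_real (freq l) * of_int m * z + \<i> * of_real \<xi>"

definition C_const :: "real \<Rightarrow> real" where
  "C_const l = 4 * pi\<^sup>2 / (3 * (freq l)\<^sup>2) + pi / freq l * sqrt (pi / 3)"

(* For u in L^1 and L^2, nu bounded and z in C_freq l, the real part of P l z m is a nonzero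
   constant for m \<noteq> 0, and by Plancherel and Cauchy-Schwarz the integrals over \<xi> and the sum
   over m converge absolutely, so no default value of LINT or infsum is involved.
   The right-hand side depends on nu only up to null sets, but the equation is imposed at every
   point of the strip, so a solution is an actual function rather than a class. *)
definition bounded_solution ::
    "real \<Rightarrow> (real \<times> real \<Rightarrow> complex) \<Rightarrow> complex \<Rightarrow> (real \<times> real \<Rightarrow> complex) \<Rightarrow> bool" where
  "bounded_solution l u z \<nu> \<longleftrightarrow>
     x_periodic l \<nu> \<and>
     \<nu> \<in> borel_measurable (lebesgue_on (Strip l)) \<and>
     bounded (\<nu> ` Strip l) \<and>
     (\<forall>(x, y) \<in> Strip l.
        \<nu> (x, y) = 1 + 1 / (2 * of_real pi) *
          (\<Sum>\<^sub>\<infinity>m\<in>UNIV - {0}. LINT \<xi>|lebesgue.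
             fourier l (\<lambda>q. u q * \<nu> q) m \<xi> / P l z m \<xi> *
             exp (\<i> * of_real (freq l * of_int m * x) + \<i> * of_real (\<xi> * y))))"

(* "mu is the unique bounded solution", for each admissible value of the parameter z. *)
definition is_Jost_function ::
    "real \<Rightarrow> (real \<times> real \<Rightarrow> complex) \<Rightarrow> (real \<times> real \<Rightarrow> complex \<Rightarrow> complex) \<Rightarrow> bool" where
  "is_Jost_function l u \<mu> \<longleftrightarrow>
     (\<forall>z \<in> C_freq l.
        bounded_solution l u z (\<lambda>q. \<mu> q z) \<and>
        (\<forall>\<nu>. bounded_solution l u z \<nu> \<longrightarrow> \<nu> = (\<lambda>q. \<mu> q z)))"

end

theory Submission
  imports Defs "HOL-Probability.Probability"
begin

text \<open>
  For fixed \<open>z\<close> the integral equation reads \<open>\<nu> = 1 + T\<^sub>z \<nu>\<close>, where \<open>T\<^sub>z\<close> multiplies by the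
  potential and then applies the Fourier multiplier with symbol \<open>1 / P\<^sub>z\<close> on the modes \<open>m
  \<noteq> 0\<close>. Holomorphy in \<open>z\<close> is obtained by perturbing this equation around each \<open>z0\<close>.

  Everything rests on one \<open>L\<^sup>2\<close> bound. The Fourier coefficients of \<open>f = u \<nu>\<close> are square
  summable over all modes and frequencies, with total at most \<open>pi / l\<close> times the energy of
  \<open>f\<close> (\<open>fourier_energy\<close>, from Bessel's inequality in \<open>x\<close> and the Plancherel inequality in
  \<open>y\<close>). A symbol that is square integrable in the same sense therefore defines, by the
  Cauchy--Schwarz inequality, a multiplier whose value at every point is bounded by a
  multiple of the square root of the energy of \<open>f\<close> (\<open>multiplier_bounds\<close>). For \<open>z0\<close> in
  \<open>C_freq l\<close> the real part of \<open>P\<close> grows at least like \<open>m\<^sup>2\<close>, uniformly for \<open>z\<close> near \<open>z0\<close>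
  (\<open>uniform_symbol_gap\<close>), and then \<open>1 / P\<close> is such a symbol. The first two Taylor
  estimates of \<open>1 / P\<^sub>z\<close> in \<open>z\<close> hold relative to \<open>1 / P\<^sub>z\<^sub>0\<close> (\<open>symbol_expansion\<close>), so \<open>z \<mapsto>
  T\<^sub>z\<close> is differentiable at \<open>z0\<close> in the operator norm of the bounded functions
  (\<open>resolvent_expansion\<close>).

  Solutions are given for all \<open>z\<close>, so it remains to control them, which is the role of the
  estimate \<open>sup |\<nu>| \<le> \<kappa> sup |\<nu> - T\<^sub>z\<^sub>0 \<nu>|\<close> for bounded \<open>\<nu>\<close>. It follows from uniqueness by
  compactness (\<open>resolvent_bounded_below\<close>). If it failed, there would be functions \<open>w\<^sub>n\<close> of
  supremum one with \<open>w\<^sub>n - T w\<^sub>n \<rightarrow> 0\<close>. The functions \<open>T w\<^sub>n\<close> are equicontinuous, so a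
  subsequence converges pointwise, and so does \<open>w\<^sub>n\<close> along it. By dominated convergence \<open>u
  w\<^sub>n\<close> then converges in \<open>L\<^sup>2\<close>, hence \<open>T w\<^sub>n\<close> converges uniformly; the limit is a nonzero
  fixed point of \<open>T\<close>, and subtracting it from \<open>\<mu>\<close> gives a second bounded solution.

  With this estimate the functions \<open>\<mu>\<^sub>z\<close> are bounded and Lipschitz near \<open>z0\<close>, and their
  difference quotients at \<open>z0\<close> satisfy a Cauchy condition, uniformly on the strip
  (\<open>solution_differentiable\<close>).
\<close>

section \<open>Integration over the strip as iterated integration\<close>

text \<open>
  The slices of a Lebesgue measurable function on the plane, and the integrals over them,
  are known only up to null sets; completeness turns such knowledge back into
  measurability.
\<close>
lemma borel_measurable_completion_AE:
  fixes f g :: "'a \<Rightarrow> 'b::topological_space"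
  assumes g: "g \<in> borel_measurable M" and ae: "AE x in M. f x = g x"
  shows "f \<in> borel_measurable (completion M)"
proof (rule borel_measurableI)
  fix S :: "'b set" assume S: "open S"
  have A: "g -` S \<inter> space M \<in> sets (completion M)"
    using g S by (intro sets_completionI_sets measurable_sets) auto
  have ae': "AE x in completion M. (x \<in> g -` S \<inter> space M) = (x \<in> f -` S \<inter> space M)"
    using AE_completion[OF ae] by eventually_elim auto
  show "f -` S \<inter> space (completion M) \<in> sets (completion M)"
    using completion.in_sets_AE[OF ae' A] by auto
qed

lemma lebesgue_borel_version:
  fixes f :: "'a::euclidean_space \<Rightarrow> complex"
  assumes "f \<in> borel_measurable lebesgue"
  obtains g where "g \<in> borel_measurable borel" "AE q in lborel. f q = g q"
proof -
  have "(\<lambda>q. Re (f q)) \<in> borel_measurable lebesgue" "(\<lambda>q. Im (f q)) \<in> borel_measurable lebesgue"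
    using assms by measurable
  then obtain a b where a: "a \<in> borel_measurable lborel" "AE q in lborel. Re (f q) = a q"
    and b: "b \<in> borel_measurable lborel" "AE q in lborel. Im (f q) = b q"
    using completion_ex_borel_measurable_real by metis
  show ?thesis
  proof
    show "(\<lambda>q. Complex (a q) (b q)) \<in> borel_measurable borel"
      using a(1) b(1) by (simp add: borel_measurable_complex_iff)
    show "AE q in lborel. f q = Complex (a q) (b q)"
      using a(2) b(2) by eventually_elim (auto simp: complex_eq_iff)
  qed
qed

lemma AE_lborel_slices:
  fixes Q :: "real \<times> real \<Rightarrow> bool"
  assumes "AE q in lborel. Q q"
  shows "AE y in lborel. AE x in lborel. Q (x, y)"
proof -
  obtain N where N0: "N \<in> null_sets (lborel :: (real \<times> real) measure)" and N: "{q. \<not> Q q} \<subseteq> N"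
    using assms unfolding eventually_ae_filter by auto
  have "N \<in> null_sets (lborel \<Otimes>\<^sub>M lborel)"
    using N0 by (simp only: lborel_prod)
  then have "AE q in lborel \<Otimes>\<^sub>M lborel. q \<notin> N"
    by (rule AE_not_in)
  then have "AE x in lborel. AE y in lborel. (x, y) \<notin> N"
    by (rule lborel_pair.AE_pair)
  moreover have "{q \<in> space (lborel \<Otimes>\<^sub>M lborel). (fst q, snd q) \<notin> N} \<in> sets (lborel \<Otimes>\<^sub>M
      (lborel :: real measure))"
  proof -
    have "{q \<in> space (lborel \<Otimes>\<^sub>M lborel). (fst q, snd q) \<notin> N} = - N" by (auto simp: space_pair_measure)
    then show ?thesis using null_setsD2[OF N0] by (simp only: lborel_prod) simp
  qed
  ultimately have "AE y in lborel. AE x in lborel. (x, y) \<notin> N"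
    by (subst (asm) lborel_pair.AE_commute)
  then show ?thesis
    using N by (auto elim!: eventually_mono)
qed

text \<open>
  The completed Lebesgue measure of the plane is not the product of the completed measures
  of the lines, so Fubini is applied to a Borel function that agrees with \<open>f\<close> almost
  everywhere; on almost every horizontal line the two also agree almost everywhere.
\<close>
lemma lebesgue_Fubini:
  fixes f :: "real \<times> real \<Rightarrow> complex"
  assumes f: "integrable lebesgue f"
  shows "(LINT y|lebesgue. LINT x|lebesgue. f (x, y)) = integral\<^sup>L lebesgue f"
proof -
  obtain g where g[measurable]: "g \<in> borel_measurable borel" and ae: "AE q in lborel. f q = g q"
    using lebesgue_borel_version f borel_measurable_integrable by metis
  have gl: "integrable lebesgue g"
    using f by (rule integrable_cong_AE_imp) (use AE_completion[OF ae] measurable_completion[of g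
        lborel borel] g in simp_all)
  then have gi: "integrable (lborel \<Otimes>\<^sub>M lborel) g"
    by (simp add: integrable_completion lborel_prod)
  have slices: "AE y in lborel. AE x in lborel. f (x, y) = g (x, y)"
    using AE_lborel_slices[OF ae] .
  have m: "(\<lambda>y. LINT x|lborel. g (x, y)) \<in> borel_measurable lborel"
    by measurable
  have inner: "AE y in lborel. (LINT x|lebesgue. f (x, y)) = (LINT x|lborel. g (x, y))"
    using slices
  proof eventually_elim
    fix y assume *: "AE x in lborel. f (x, y) = g (x, y)"
    have gm: "(\<lambda>x. g (x, y)) \<in> borel_measurable lborel" by measurable
    have "(LINT x|lebesgue. f (x, y)) = (LINT x|lebesgue. g (x, y))"
      by (rule integral_cong_AE)
        (use borel_measurable_completion_AE[OF gm *] measurable_completion[OF gm] AE_completion[OF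
            *] in auto)
    then show "(LINT x|lebesgue. f (x, y)) = (LINT x|lborel. g (x, y))"
      using integral_completion[OF gm] by simp
  qed
  have "(LINT y|lebesgue. LINT x|lebesgue. f (x, y)) = (LINT y|lebesgue. LINT x|lborel. g (x, y))"
    by (rule integral_cong_AE)
      (use borel_measurable_completion_AE[OF m inner] measurable_completion[OF m] AE_completion[OF
          inner] in auto)
  also have "\<dots> = (LINT y|lborel. LINT x|lborel. g (x, y))"
    by (rule integral_completion[OF m])
  also have "\<dots> = integral\<^sup>L (lborel \<Otimes>\<^sub>M lborel) g"
    using lborel_pair.integral_snd[of "\<lambda>x y. g (x, y)"] gi by simp
  also have "\<dots> = integral\<^sup>L lebesgue g"
    by (simp add: integral_completion lborel_prod)
  also have "\<dots> = integral\<^sup>L lebesgue f"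
    by (rule integral_cong_AE) (use gl f AE_completion[OF ae] in \<open>simp_all add: eq_commute\<close>)
  finally show ?thesis .
qed

definition plane_wave :: "real \<Rightarrow> int \<Rightarrow> real \<Rightarrow> real \<times> real \<Rightarrow> complex" where
  "plane_wave l m \<xi> q = exp (\<i> * of_real (freq l * of_int m * fst q) + \<i> * of_real (\<xi> * snd q))"

lemma norm_plane_wave [simp]: "cmod (plane_wave l m \<xi> q) = 1"
  by (simp add: plane_wave_def norm_exp_eq_Re)

lemma cnj_plane_wave:
  "cnj (plane_wave l m \<xi> q) = exp (- \<i> * of_real (freq l * of_int m * fst q) - \<i> * of_real (\<xi> * snd q))"
  by (simp add: plane_wave_def exp_cnj)

lemma continuous_plane_wave: "continuous_on S (plane_wave l m \<xi>)"
  unfolding plane_wave_def by (intro continuous_intros)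

lemma plane_wave_borel [measurable]: "plane_wave l m \<xi> \<in> borel_measurable borel"
  by (intro borel_measurable_continuous_onI continuous_plane_wave)

lemma cnj_plane_wave_borel [measurable]: "(\<lambda>q. cnj (plane_wave l m \<xi> q)) \<in> borel_measurable borel"
  by (intro borel_measurable_continuous_onI continuous_on_cnj continuous_plane_wave)

lemma Strip_borel [measurable]: "Strip l \<in> sets borel"
  unfolding Strip_def by (intro borel_closed closed_Times) auto

lemma Strip_lebesgue [simp]: "Strip l \<inter> space lebesgue \<in> sets lebesgue" "Strip l \<in> sets lebesgue"
  by (auto intro: sets_completionI_sets)

lemma borel_imp_lebesgue_on: "f \<in> borel_measurable borel \<Longrightarrow> f \<in> borel_measurable (lebesgue_on S)"
  by (intro measurable_restrict_space1 measurable_completion) simp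

text \<open>
  The iterated integral defining the Fourier coefficients is an integral over the strip.
  In this form it is linear in \<open>f\<close> and insensitive to null sets.
\<close>
lemma fourier_eq_plane_integral:
  assumes f: "integrable (lebesgue_on (Strip l)) f"
  shows "fourier l f m \<xi> = 1 / (2 * of_real l) *
    (LINT q|lebesgue_on (Strip l). f q * cnj (plane_wave l m \<xi> q))"
proof -
  let ?h = "\<lambda>q. indicator (Strip l) q *\<^sub>R (f q * cnj (plane_wave l m \<xi> q))"
  have "integrable (lebesgue_on (Strip l)) (\<lambda>q. f q * cnj (plane_wave l m \<xi> q))"
    by (rule Bochner_Integration.integrable_bound[OF f])
      (use borel_measurable_integrable[OF f] borel_imp_lebesgue_on[OF cnj_plane_wave_borel]
        in \<open>auto simp: norm_mult intro!: borel_measurable_times\<close>)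
  then have i: "integrable lebesgue ?h"
    by (simp add: integrable_restrict_space)
  have "(LINT y|lebesgue. LINT x|lebesgue_on {-l..l}. f (x, y) * cnj (plane_wave l m \<xi> (x, y)))
      = (LINT y|lebesgue. LINT x|lebesgue. ?h (x, y))"
  proof (rule Bochner_Integration.integral_cong[OF refl])
    fix y :: real assume "y \<in> space lebesgue"
    have "(LINT x|lebesgue_on {-l..l}. f (x, y) * cnj (plane_wave l m \<xi> (x, y)))
        = (LINT x|lebesgue. indicator {-l..l} x *\<^sub>R (f (x, y) * cnj (plane_wave l m \<xi> (x, y))))"
      by (rule integral_restrict_space) simp
    also have "\<dots> = (LINT x|lebesgue. ?h (x, y))"
      by (simp add: Strip_def indicator_def)
    finally show "(LINT x|lebesgue_on {-l..l}. f (x, y) * cnj (plane_wave l m \<xi> (x, y)))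
        = (LINT x|lebesgue. ?h (x, y))" .
  qed
  also have "\<dots> = integral\<^sup>L lebesgue ?h"
    by (rule lebesgue_Fubini[OF i])
  also have "\<dots> = (LINT q|lebesgue_on (Strip l). f q * cnj (plane_wave l m \<xi> q))"
    by (simp add: integral_restrict_space)
  finally show ?thesis
    by (simp add: fourier_def cnj_plane_wave)
qed

section \<open>The Plancherel inequality on the line\<close>

text \<open>
  The transform of a Gaussian is a multiple of a normal density, whose total mass is
  known. Both integrals that occur when regularizing the Plancherel identity are read off
  from this.
\<close>
lemma gaussian_fourier_transform:
  assumes e: "\<epsilon> > 0"
  shows "integrable lborel (\<lambda>\<xi>. exp (- (\<epsilon> * \<xi>)\<^sup>2 / 2) :: real)"
    and "(LINT \<xi>|lborel. of_real (exp (- (\<epsilon> * \<xi>)\<^sup>2 / 2)) * exp (- \<i> * of_real (\<xi> * r)))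
      = complex_of_real (2 * pi * normal_density 0 \<epsilon> r)"
proof -
  have n: "exp (- (\<epsilon> * \<xi>)\<^sup>2 / 2) = sqrt (2 * pi) * std_normal_density (\<epsilon> * \<xi>)" for \<xi>
    by (simp add: std_normal_density_def)
  have i: "integrable lborel std_normal_density" by simp
  show "integrable lborel (\<lambda>\<xi>. exp (- (\<epsilon> * \<xi>)\<^sup>2 / 2))"
    unfolding n using lborel_integrable_real_affine[OF i, of \<epsilon> 0] e by simp
  let ?f = "\<lambda>x. of_real (std_normal_density x) * exp (- \<i> * of_real (x * (r / \<epsilon>)))"
  have "complex_of_real (exp (- (r / \<epsilon>)\<^sup>2 / 2)) = char std_normal_distribution (- (r / \<epsilon>))"
    by (simp add: char_std_normal_distribution)
  also have "\<dots> = (LINT x|lborel. ?f x)"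
    unfolding char_def by (subst integral_density) (auto simp: scaleR_conv_of_real mult_ac)
  also have "\<dots> = \<epsilon> * (LINT \<xi>|lborel. ?f (\<epsilon> * \<xi>))"
    using lborel_integral_real_affine[of \<epsilon> ?f 0] e by (simp add: scaleR_conv_of_real)
  finally have *: "(LINT \<xi>|lborel. ?f (\<epsilon> * \<xi>)) = complex_of_real (exp (- (r / \<epsilon>)\<^sup>2 / 2) / \<epsilon>)"
    using e by (simp add: field_simps)
  have "(LINT \<xi>|lborel. of_real (exp (- (\<epsilon> * \<xi>)\<^sup>2 / 2)) * exp (- \<i> * of_real (\<xi> * r)))
      = (LINT \<xi>|lborel. of_real (sqrt (2 * pi)) * ?f (\<epsilon> * \<xi>))"
    unfolding n using e by (intro Bochner_Integration.integral_cong) (auto simp: mult_ac)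
  also have "\<dots> = of_real (sqrt (2 * pi)) * complex_of_real (exp (- (r / \<epsilon>)\<^sup>2 / 2) / \<epsilon>)"
    by (simp only: integral_mult_right_zero *)
  also have "\<dots> = complex_of_real (2 * pi * normal_density 0 \<epsilon> r)"
  proof -
    have "sqrt (2 * pi) * (exp (- (r / \<epsilon>)\<^sup>2 / 2) / \<epsilon>) = 2 * pi * normal_density 0 \<epsilon> r"
    proof -
      have "sqrt (2 * pi * \<epsilon>\<^sup>2) = sqrt (2 * pi) * \<epsilon>"
        using e by (simp add: real_sqrt_mult)
      moreover have "sqrt (2 * pi) * sqrt (2 * pi) = 2 * pi" by simp
      ultimately show ?thesis
        using e by (simp add: normal_density_def field_simps power_divide)
    qed
    then show ?thesis by (metis of_real_mult)
  qed
  finally show "(LINT \<xi>|lborel. of_real (exp (- (\<epsilon> * \<xi>)\<^sup>2 / 2)) * exp (- \<i> * of_real (\<xi> * r)))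
      = complex_of_real (2 * pi * normal_density 0 \<epsilon> r)" .
qed

lemma integrable_lborel_pair_mult:
  fixes F G :: "real \<Rightarrow> 'a::{real_normed_algebra, banach, second_countable_topology}"
  assumes "integrable lborel F" "integrable lborel G"
  shows "integrable (lborel \<Otimes>\<^sub>M lborel) (\<lambda>(s, t). F s * G t)"
proof (rule lborel_pair.Fubini_integrable)
  have [measurable]: "F \<in> borel_measurable borel" "G \<in> borel_measurable borel"
    using assms borel_measurable_integrable by auto
  show "(\<lambda>(s, t). F s * G t) \<in> borel_measurable (lborel \<Otimes>\<^sub>M lborel)"
    by measurable
  have "integrable lborel (\<lambda>t. norm (F s * G t))" for s
    by (intro integrable_norm integrable_mult_right assms)
  show "AE s in lborel. integrable lborel (\<lambda>t. case (s, t) of (s, t) \<Rightarrow> F s * G t)"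
    using assms by auto
  show "integrable lborel (\<lambda>s. LINT t|lborel. norm (case (s, t) of (s, t) \<Rightarrow> F s * G t))"
  proof (rule Bochner_Integration.integrable_bound)
    show "integrable lborel (\<lambda>s. norm (F s) * (LINT t|lborel. norm (G t)))"
      using assms by auto
    show "AE s in lborel. norm (LINT t|lborel. norm (case (s, t) of (s, t) \<Rightarrow> F s * G t))
        \<le> norm (norm (F s) * (LINT t|lborel. norm (G t)))"
    proof (intro AE_I2)
      fix s
      have "(LINT t|lborel. norm (F s * G t)) \<le> (LINT t|lborel. norm (F s) * norm (G t))"
        using assms by (intro integral_mono) (auto simp: norm_mult_ineq)
      then show "norm (LINT t|lborel. norm (case (s, t) of (s, t) \<Rightarrow> F s * G t))
        \<le> norm (norm (F s) * (LINT t|lborel. norm (G t)))"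
        by simp
    qed
  qed measurable
qed

text \<open>
  With the Gaussian weight the integral of \<open>|Gh|\<^sup>2\<close> may be expanded by Fubini into a
  double integral of \<open>G(s) cnj(G(t))\<close> against \<open>2 pi\<close> times a normal density in \<open>s - t\<close>.
  The inequality \<open>2ab \<le> a\<^sup>2 + b\<^sup>2\<close> and the unit mass of the density give a bound that does
  not depend on \<open>\<epsilon>\<close>.
\<close>
lemma damped_plancherel:
  fixes G :: "real \<Rightarrow> complex"
  assumes G1: "integrable lborel G" and G2: "integrable lborel (\<lambda>t. (cmod (G t))\<^sup>2)" and e: "\<epsilon> > 0"
  defines "Gh \<equiv> \<lambda>\<xi>. LINT t|lborel. G t * exp (- \<i> * of_real (\<xi> * t))"
  shows "integrable lborel (\<lambda>\<xi>. exp (- (\<epsilon> * \<xi>)\<^sup>2 / 2) * (cmod (Gh \<xi>))\<^sup>2)"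
    and "(LINT \<xi>|lborel. exp (- (\<epsilon> * \<xi>)\<^sup>2 / 2) * (cmod (Gh \<xi>))\<^sup>2)
        \<le> 2 * pi * (LINT t|lborel. (cmod (G t))\<^sup>2)"
proof -
  have Gm[measurable]: "G \<in> borel_measurable borel"
    using G1 by auto
  define W where "W \<xi> = exp (- (\<epsilon> * \<xi>)\<^sup>2 / 2)" for \<xi> :: real
  have Wi: "integrable lborel W"
    unfolding W_def by (rule gaussian_fourier_transform(1)[OF e])
  have Wm[measurable]: "W \<in> borel_measurable borel"
    using Wi by auto
  have W0: "W \<xi> > 0" for \<xi> by (simp add: W_def)
  let ?P = "lborel \<Otimes>\<^sub>M lborel :: (real \<times> real) measure"
  define H where "H p = G (fst p) * cnj (G (snd p))" for p
  have Hi: "integrable ?P H"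
    using integrable_lborel_pair_mult[OF G1, of "\<lambda>t. cnj (G t)"] G1
    by (simp add: H_def[abs_def] case_prod_beta')
  have Hm[measurable]: "H \<in> borel_measurable ?P"
    using Hi by auto
  have ei: "integrable lborel (\<lambda>t. G t * exp (- \<i> * of_real (\<xi> * t)))" for \<xi>
    by (rule Bochner_Integration.integrable_bound[OF G1]) (auto simp: norm_mult)
  have Ghm[measurable]: "Gh \<in> borel_measurable borel"
    unfolding Gh_def by measurable
  have sq: "complex_of_real ((cmod (Gh \<xi>))\<^sup>2) = (LINT p|?P. H p * exp (- \<i> * of_real (\<xi> * (fst p
      - snd p))))" for \<xi>
  proof -
    let ?g = "\<lambda>t. G t * exp (- \<i> * of_real (\<xi> * t))"
    have c: "integrable lborel (\<lambda>t. cnj (?g t))" using ei by (rule integrable_cnj)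
    have "complex_of_real ((cmod (Gh \<xi>))\<^sup>2) = (LINT t|lborel. ?g t) * (LINT t|lborel. cnj (?g t))"
      unfolding Gh_def complex_norm_square by (simp only: integral_bounded_linear[OF
          bounded_linear_cnj ei])
    also have "\<dots> = (LINT s|lborel. LINT t|lborel. ?g s * cnj (?g t))"
      by (simp only: integral_mult_right_zero integral_mult_left_zero)
    also have "\<dots> = (LINT p|?P. ?g (fst p) * cnj (?g (snd p)))"
      using lborel_pair.integral_fst[OF integrable_lborel_pair_mult[OF ei c]]
      by (simp add: case_prod_beta')
    also have "\<dots> = (LINT p|?P. H p * exp (- \<i> * of_real (\<xi> * (fst p - snd p))))"
      by (intro Bochner_Integration.integral_cong)
        (auto simp: H_def exp_cnj exp_add[symmetric] exp_minus algebra_simps exp_diff divide_inverse)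
    finally show ?thesis .
  qed
  interpret Q: pair_sigma_finite lborel ?P ..
  \<comment> \<open>Integrating first over \<open>\<xi>\<close> or first over \<open>p = (s, t)\<close> gives the two sides of the estimate.\<close>
  define K where "K \<xi> p = of_real (W \<xi>) * (H p * exp (- \<i> * of_real (\<xi> * (fst p - snd p))))" for \<xi> p
  have Ki: "integrable (lborel \<Otimes>\<^sub>M ?P) (case_prod K)"
  proof (rule Q.Fubini_integrable)
    show "case_prod K \<in> borel_measurable (lborel \<Otimes>\<^sub>M ?P)"
      unfolding K_def by measurable
    have nK: "cmod (K \<xi> p) = W \<xi> * cmod (H p)" for \<xi> p
      using W0[of \<xi>] by (simp add: K_def norm_mult)
    show "integrable lborel (\<lambda>\<xi>. LINT p|?P. norm (case (\<xi>, p) of (\<xi>, p) \<Rightarrow> K \<xi> p))"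
      using Wi by (simp add: nK)
    show "AE \<xi> in lborel. integrable ?P (\<lambda>p. case (\<xi>, p) of (\<xi>, p) \<Rightarrow> K \<xi> p)"
    proof (intro AE_I2)
      fix \<xi>
      have Km: "K \<xi> \<in> borel_measurable ?P"
        unfolding K_def[abs_def] by measurable
      have Wi: "integrable ?P (\<lambda>p. W \<xi> * cmod (H p))"
        using Hi by simp
      have "integrable ?P (K \<xi>)"
        by (rule Bochner_Integration.integrable_bound[OF Wi Km]) (use W0[of \<xi>] in \<open>simp add: nK\<close>)
      then show "integrable ?P (\<lambda>p. case (\<xi>, p) of (\<xi>, p) \<Rightarrow> K \<xi> p)"
        by simp
    qed
  qed
  have inner: "(LINT p|?P. K \<xi> p) = of_real (W \<xi> * (cmod (Gh \<xi>))\<^sup>2)" for \<xi>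
    unfolding K_def integral_mult_right_zero of_real_mult[of "W \<xi>"] sq ..
  have "integrable lborel (\<lambda>\<xi>. complex_of_real (W \<xi> * (cmod (Gh \<xi>))\<^sup>2))"
    using Q.integrable_fst[OF Ki] by (simp only: inner)
  then show "integrable lborel (\<lambda>\<xi>. exp (- (\<epsilon> * \<xi>)\<^sup>2 / 2) * (cmod (Gh \<xi>))\<^sup>2)"
    unfolding W_def[symmetric] complex_of_real_integrable_eq .
  let ?N = "\<lambda>s t. 2 * pi * normal_density 0 \<epsilon> (s - t)"
  have "complex_of_real (LINT \<xi>|lborel. W \<xi> * (cmod (Gh \<xi>))\<^sup>2) = (LINT \<xi>|lborel. LINT p|?P. K \<xi> p)"
    by (simp only: inner integral_complex_of_real)
  also have "\<dots> = (LINT p|?P. LINT \<xi>|lborel. K \<xi> p)"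
    using Q.Fubini_integral[OF Ki] by simp
  also have "\<dots> = (LINT p|?P. H p * of_real (?N (fst p) (snd p)))"
  proof (rule Bochner_Integration.integral_cong[OF refl])
    fix p
    have "(LINT \<xi>|lborel. K \<xi> p) = (LINT \<xi>|lborel. H p * (of_real (W \<xi>) * exp (- \<i> * of_real (\<xi> *
        (fst p - snd p)))))"
      unfolding K_def by (simp add: mult_ac)
    also have "\<dots> = H p * of_real (?N (fst p) (snd p))"
      unfolding integral_mult_right_zero W_def gaussian_fourier_transform(2)[OF e] ..
    finally show "(LINT \<xi>|lborel. K \<xi> p) = H p * of_real (?N (fst p) (snd p))" .
  qed
  finally have eq: "complex_of_real (LINT \<xi>|lborel. W \<xi> * (cmod (Gh \<xi>))\<^sup>2)
      = (LINT p|?P. H p * of_real (?N (fst p) (snd p)))" .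
  define a where "a t = (cmod (G t))\<^sup>2" for t
  have am[measurable]: "a \<in> borel_measurable borel" unfolding a_def by measurable
  have N1: "(\<integral>\<^sup>+ s. ennreal (?N s t) \<partial>lborel) = ennreal (2 * pi)" for t
  proof -
    have "normal_density 0 \<epsilon> (s - t) = normal_density t \<epsilon> s" for s
      by (simp add: normal_density_def)
    then have "ennreal (?N s t) = ennreal (2 * pi) * ennreal (normal_density t \<epsilon> s)" for s
      by (simp only: ennreal_mult'[of "2 * pi"] pi_ge_zero zero_le_mult_iff zero_le_numeral simp_thms)
    then have "(\<integral>\<^sup>+ s. ennreal (?N s t) \<partial>lborel)
        = ennreal (2 * pi) * (\<integral>\<^sup>+ s. ennreal (normal_density t \<epsilon> s) \<partial>lborel)"
      by (simp only:) (rule nn_integral_cmult, measurable)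
    also have "(\<integral>\<^sup>+ s. ennreal (normal_density t \<epsilon> s) \<partial>lborel) = 1"
      using e by (subst nn_integral_eq_integral) auto
    finally show ?thesis by simp
  qed
  have sym: "?N s t = ?N t s" for s t
    by (simp add: normal_density_def power2_commute)
  have Nm[measurable]: "(\<lambda>p. ennreal (?N (fst p) (snd p))) \<in> borel_measurable ?P"
    by measurable
  have A: "(\<integral>\<^sup>+ p. ennreal (a (snd p)) * ennreal (?N (fst p) (snd p)) \<partial>?P)
      = (\<integral>\<^sup>+ t. ennreal (a t) \<partial>lborel) * ennreal (2 * pi)"
  proof -
    have "(\<integral>\<^sup>+ p. ennreal (a (snd p)) * ennreal (?N (fst p) (snd p)) \<partial>?P)
      = (\<integral>\<^sup>+ t. \<integral>\<^sup>+ s. ennreal (a t) * ennreal (?N s t) \<partial>lborel \<partial>lborel)"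
      by (subst lborel_pair.nn_integral_snd[symmetric]) auto
    also have "\<dots> = (\<integral>\<^sup>+ t. ennreal (a t) * ennreal (2 * pi) \<partial>lborel)"
      by (subst nn_integral_cmult) (simp_all only: N1, measurable)
    also have "\<dots> = (\<integral>\<^sup>+ t. ennreal (a t) \<partial>lborel) * ennreal (2 * pi)"
      by (rule nn_integral_multc) measurable
    finally show ?thesis .
  qed
  have B: "(\<integral>\<^sup>+ p. ennreal (a (fst p)) * ennreal (?N (fst p) (snd p)) \<partial>?P)
      = (\<integral>\<^sup>+ t. ennreal (a t) \<partial>lborel) * ennreal (2 * pi)"
  proof -
    have "(\<integral>\<^sup>+ p. ennreal (a (fst p)) * ennreal (?N (fst p) (snd p)) \<partial>?P)
      = (\<integral>\<^sup>+ s. \<integral>\<^sup>+ t. ennreal (a s) * ennreal (?N t s) \<partial>lborel \<partial>lborel)"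
      by (subst lborel.nn_integral_fst[symmetric]) (auto simp: sym)
    also have "\<dots> = (\<integral>\<^sup>+ t. ennreal (a t) * ennreal (2 * pi) \<partial>lborel)"
      by (subst nn_integral_cmult) (simp_all only: N1, measurable)
    also have "\<dots> = (\<integral>\<^sup>+ t. ennreal (a t) \<partial>lborel) * ennreal (2 * pi)"
      by (rule nn_integral_multc) measurable
    finally show ?thesis .
  qed
  have a1: "(\<integral>\<^sup>+ t. ennreal (a t) \<partial>lborel) = ennreal (LINT t|lborel. a t)"
    using G2 unfolding a_def by (intro nn_integral_eq_integral) auto
  have "ennreal (cmod (LINT p|?P. H p * of_real (?N (fst p) (snd p))))
    \<le> (\<integral>\<^sup>+ p. ennreal (cmod (H p * of_real (?N (fst p) (snd p)))) \<partial>?P)"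
    by (cases "integrable ?P (\<lambda>p. H p * of_real (?N (fst p) (snd p)))")
      (auto intro: integral_norm_bound_ennreal simp: not_integrable_integral_eq)
  also have "\<dots> \<le> (\<integral>\<^sup>+ p. ennreal (1/2) * (ennreal (a (fst p)) * ennreal (?N (fst p) (snd p))
      + ennreal (a (snd p)) * ennreal (?N (fst p) (snd p))) \<partial>?P)"
  proof (rule nn_integral_mono)
    fix p :: "real \<times> real"
    let ?n = "?N (fst p) (snd p)"
    have n0: "?n \<ge> 0" by (simp add: normal_density_def)
    have "cmod (G (fst p)) * cmod (G (snd p)) \<le> (a (fst p) + a (snd p)) / 2"
      unfolding a_def using sum_squares_bound[of "cmod (G (fst p))" "cmod (G (snd p))"] by simp
    then have "cmod (G (fst p)) * cmod (G (snd p)) * ?n \<le> (a (fst p) + a (snd p)) / 2 * ?n"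
      using n0 by (rule mult_right_mono)
    moreover have "cmod (H p * of_real ?n) = cmod (G (fst p)) * cmod (G (snd p)) * ?n"
      unfolding H_def norm_mult complex_mod_cnj norm_of_real abs_of_nonneg[OF n0] ..
    ultimately have "cmod (H p * of_real ?n) \<le> (a (fst p) + a (snd p)) / 2 * ?n"
      by simp
    also have "\<dots> = 1/2 * (a (fst p) * ?n + a (snd p) * ?n)"
      by (simp add: algebra_simps)
    finally have "ennreal (cmod (H p * of_real ?n)) \<le> ennreal (1/2 * (a (fst p) * ?n + a (snd p) * ?n))"
      by (rule ennreal_leI)
    also have "\<dots> = ennreal (1/2) * (ennreal (a (fst p)) * ennreal ?n + ennreal (a
        (snd p)) * ennreal ?n)"
      using n0 by (simp only: ennreal_mult' ennreal_mult'' ennreal_plus a_def zero_le_power2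
          mult_nonneg_nonneg 
        zero_le_divide_1_iff zero_le_numeral)
    finally show "ennreal (cmod (H p * of_real ?n))
        \<le> ennreal (1/2) * (ennreal (a (fst p)) * ennreal ?n + ennreal (a (snd p)) * ennreal ?n)" .
  qed
  also have "\<dots> = ennreal (1/2) * (ennreal (LINT t|lborel. a t) * ennreal (2 * pi) + ennreal
      (LINT t|lborel. a t) * ennreal (2 * pi))"
    by (subst nn_integral_cmult, measurable) (subst nn_integral_add, measurable, simp only: A B a1)
  also have "\<dots> = ennreal (2 * pi * (LINT t|lborel. a t))"
  proof -
    define I where "I = (LINT t|lborel. a t)"
    have I0: "I \<ge> 0" by (simp add: I_def a_def)
    have "ennreal (1/2) * (ennreal I * ennreal (2 * pi) + ennreal I * ennreal (2 * pi))
        = ennreal (1/2 * (I * (2 * pi) + I * (2 * pi)))"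
      by (simp only: ennreal_mult' ennreal_plus mult_nonneg_nonneg pi_ge_zero zero_le_numeral I0
          zero_le_divide_1_iff)
    then show ?thesis
      unfolding I_def[symmetric] by (simp add: mult_ac)
  qed
  finally have "cmod (LINT p|?P. H p * of_real (?N (fst p) (snd p))) \<le> 2 * pi * (LINT t|lborel. a t)"
    by (subst (asm) ennreal_le_iff) (auto simp: a_def[abs_def])
  then have "\<bar>LINT \<xi>|lborel. W \<xi> * (cmod (Gh \<xi>))\<^sup>2\<bar> \<le> 2 * pi * (LINT t|lborel. a t)"
    using eq by (metis norm_of_real)
  then show "(LINT \<xi>|lborel. exp (- (\<epsilon> * \<xi>)\<^sup>2 / 2) * (cmod (Gh \<xi>))\<^sup>2)
      \<le> 2 * pi * (LINT t|lborel. (cmod (G t))\<^sup>2)"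
    unfolding W_def a_def by linarith
qed

text \<open>
  Let \<open>\<epsilon>\<close> tend to zero in the damped inequality, using Fatou's lemma.
\<close>
lemma plancherel_inequality:
  fixes G :: "real \<Rightarrow> complex"
  assumes G1: "integrable lborel G" and G2: "integrable lborel (\<lambda>t. (cmod (G t))\<^sup>2)"
  shows "(\<integral>\<^sup>+ \<xi>. ennreal ((cmod (LINT t|lborel. G t * exp (- \<i> * of_real (\<xi> * t))))\<^sup>2) \<partial>lborel)
    \<le> ennreal (2 * pi * (LINT t|lborel. (cmod (G t))\<^sup>2))"
proof -
  define Gh where "Gh \<xi> = (LINT t|lborel. G t * exp (- \<i> * of_real (\<xi> * t)))" for \<xi> :: real
  have Gm[measurable]: "G \<in> borel_measurable borel"
    using G1 by auto
  have Ghm[measurable]: "Gh \<in> borel_measurable borel"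
    unfolding Gh_def by measurable
  define w where "w n \<xi> = exp (- (1 / real (Suc n) * \<xi>)\<^sup>2 / 2) * (cmod (Gh \<xi>))\<^sup>2" for n \<xi>
  have "(\<integral>\<^sup>+ \<xi>. ennreal ((cmod (Gh \<xi>))\<^sup>2) \<partial>lborel) = (\<integral>\<^sup>+ \<xi>. liminf (\<lambda>n. ennreal (w n \<xi>)) \<partial>lborel)"
  proof (rule nn_integral_cong)
    fix \<xi> :: real
    have "(\<lambda>n. w n \<xi>) \<longlonglongrightarrow> exp (- (0 * \<xi>)\<^sup>2 / 2) * (cmod (Gh \<xi>))\<^sup>2"
      unfolding w_def using LIMSEQ_Suc[OF lim_1_over_n] by (intro tendsto_intros) auto
    then have "(\<lambda>n. ennreal (w n \<xi>)) \<longlonglongrightarrow> ennreal ((cmod (Gh \<xi>))\<^sup>2)"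
      by (intro tendsto_ennrealI) simp
    from lim_imp_Liminf[OF _ this] show "ennreal ((cmod (Gh \<xi>))\<^sup>2)
        = liminf (\<lambda>n. ennreal (w n \<xi>))" by simp
  qed
  also have "\<dots> \<le> liminf (\<lambda>n. \<integral>\<^sup>+ \<xi>. ennreal (w n \<xi>) \<partial>lborel)"
    by (rule nn_integral_liminf) (simp add: w_def)
  also have "\<dots> \<le> liminf (\<lambda>n::nat. ennreal (2 * pi * (LINT t|lborel. (cmod (G t))\<^sup>2)))"
  proof (intro Liminf_mono always_eventually allI)
    fix n
    note d = damped_plancherel[OF G1 G2, of "1 / real (Suc n)", folded Gh_def, folded w_def]
    have "(\<integral>\<^sup>+ \<xi>. ennreal (w n \<xi>) \<partial>lborel) = ennreal (LINT \<xi>|lborel. w n \<xi>)"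
      using d(1) by (intro nn_integral_eq_integral) (auto simp: w_def)
    also have "\<dots> \<le> ennreal (2 * pi * (LINT t|lborel. (cmod (G t))\<^sup>2))"
      using d(2) by (intro ennreal_leI) auto
    finally show "(\<integral>\<^sup>+ \<xi>. ennreal (w n \<xi>) \<partial>lborel)
        \<le> ennreal (2 * pi * (LINT t|lborel. (cmod (G t))\<^sup>2))" .
  qed
  also have "\<dots> = ennreal (2 * pi * (LINT t|lborel. (cmod (G t))\<^sup>2))"
    by (rule Liminf_const) simp
  finally show ?thesis unfolding Gh_def .
qed

section \<open>Square sums of the Fourier coefficients\<close>

lemma freq_times: "l > 0 \<Longrightarrow> freq l * l = pi" "l > 0 \<Longrightarrow> freq l > 0"
  by (simp_all add: freq_def)

lemma exponential_orthogonality: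
  assumes l: "l > 0"
  shows "integrable lborel (\<lambda>x. indicator {-l..l} x *\<^sub>R exp (\<i> * of_real (freq l * of_int k * x)))"
    and "(LINT x|lborel. indicator {-l..l} x *\<^sub>R exp (\<i> * of_real (freq l * of_int k * x))) = (if k
        = 0 then 2 * of_real l else 0)"
proof -
  let ?f = "\<lambda>x. exp (\<i> * of_real (freq l * of_int k * x))"
  have c: "continuous_on {-l..l} ?f" by (intro continuous_intros)
  then show "integrable lborel (\<lambda>x. indicator {-l..l} x *\<^sub>R ?f x)"
    using borel_integrable_compact[of "{-l..l}" ?f] by
        (simp add: scaleR_conv_of_real indicator_def if_distrib cong: if_cong)
  show "(LINT x|lborel. indicator {-l..l} x *\<^sub>R ?f x) = (if k = 0 then 2 * of_real l else 0)"
  proof (cases "k = 0")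
    case True
    have "(LINT x|lborel. indicator {-l..l} x *\<^sub>R (1::complex)) = of_real (2 * l)"
      using l by (subst integral_scaleR_left) (auto simp: scaleR_conv_of_real)
    then show ?thesis using True by simp
  next
    case False
    define b where "b = \<i> * of_real (freq l * of_int k)"
    have b: "b \<noteq> 0" using False freq_times(2)[OF l] by (simp add: b_def)
    have "(LINT x|lborel. indicator {-l..l} x *\<^sub>R ?f x)
        = exp (b * of_real l) / b - exp (b * of_real (- l)) / b"
    proof (rule integral_FTC_Icc[where F = "\<lambda>x. exp (b * of_real x) / b"])
      fix x :: real
      have "((\<lambda>z. exp (b * z) / b) has_field_derivative exp (b * of_real x)) (at (of_real x))"
        using b by (auto intro!: derivative_eq_intros)
      from field_differentiable_at_within has_vector_derivative_real_field[OF this]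
      show "((\<lambda>x. exp (b * of_real x) / b) has_vector_derivative ?f x) (at x within {-l..l})"
        by (simp add: b_def mult_ac)
    qed (use l c in auto)
    also have "exp (b * of_real l) = exp (b * of_real (- l))"
    proof -
      have "b * of_real l = b * of_real (- l) + 2 * of_int k * (of_real (freq l * l)) * \<i>"
        by (simp add: b_def algebra_simps)
      then have "b * of_real l = b * of_real (- l) + of_real (real_of_int (2 * k) * pi) * \<i>"
        unfolding freq_times[OF l] by simp
      then show ?thesis
        unfolding exp_eq by (intro exI[of _ k])
    qed
    finally show ?thesis using False by simp
  qed
qed

text \<open>
  Writing \<open>p\<close> for the partial Fourier sum, \<open>h\<close> and \<open>p\<close> have the same inner product with
  \<open>p\<close>, namely \<open>2 l\<close> times the left-hand side; integrate \<open>0 \<le> |h - p|\<^sup>2\<close>.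
\<close>
lemma bessel_inequality:
  fixes h :: "real \<Rightarrow> complex"
  assumes l: "l > 0" and h1: "integrable lborel h" and h2: "integrable lborel (\<lambda>x. (cmod (h x))\<^sup>2)"
    and supp: "\<And>x. x \<notin> {-l..l} \<Longrightarrow> h x = 0" and A: "finite A"
  defines "c \<equiv> \<lambda>m. 1 / (2 * of_real l) * (LINT x|lborel. h x * exp (- \<i> * of_real
      (freq l * of_int m * x)))"
  shows "(\<Sum>m\<in>A. (cmod (c m))\<^sup>2) \<le> 1 / (2 * l) * (LINT x|lborel. (cmod (h x))\<^sup>2)"
proof -
  define e where "e m x = exp (\<i> * of_real (freq l * of_int m * x))" for m x
  have ce: "cnj (e m x) = exp (- \<i> * of_real (freq l * of_int m * x))" for m x
    by (simp add: e_def exp_cnj)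
  have e1: "cmod (e m x) = 1" for m x by (simp add: e_def norm_exp_eq_Re)
  have eb: "(\<lambda>x. cnj (e m x)) \<in> borel_measurable borel" for m
    unfolding e_def by (intro borel_measurable_continuous_onI continuous_intros)
  have ee: "e m x * cnj (e n x) = exp (\<i> * of_real (freq l * of_int (m - n) * x))" for m n x
    unfolding ce unfolding e_def by (simp add: exp_add[symmetric] algebra_simps)
  define s where "s = (\<Sum>m\<in>A. (cmod (c m))\<^sup>2)"
  define p where "p x = (\<Sum>m\<in>A. c m * e m x)" for x
  let ?I = "indicator {-l..l} :: real \<Rightarrow> real"
  have hei: "integrable lborel (\<lambda>x. h x * cnj (e m x))" for m
    by (rule Bochner_Integration.integrable_bound[OF h1])
      (use h1 eb in \<open>auto simp: norm_mult e1 intro!: borel_measurable_times\<close>)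
  have cm: "(LINT x|lborel. h x * cnj (e m x)) = 2 * of_real l * c m" for m
    unfolding c_def ce using l by simp
  have hp: "h x * cnj (p x) = (\<Sum>m\<in>A. cnj (c m) * (h x * cnj (e m x)))" for x
    by (simp add: p_def sum_distrib_left mult_ac)
  have ihp: "integrable lborel (\<lambda>x. h x * cnj (p x))"
    unfolding hp using hei by (intro Bochner_Integration.integrable_sum integrable_mult_right)
  have "(LINT x|lborel. h x * cnj (p x)) = (\<Sum>m\<in>A. cnj (c m) * (2 * of_real l * c m))"
    unfolding hp using hei by (subst Bochner_Integration.integral_sum) (auto simp: cm)
  also have "\<dots> = of_real (2 * l * s)"
    unfolding s_def of_real_mult of_real_sum complex_norm_square sum_distrib_left
    by (intro sum.cong) (auto simp: mult_ac complex_norm_square[symmetric])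
  finally have H: "(LINT x|lborel. h x * cnj (p x)) = of_real (2 * l * s)" .
  have pp: "?I x *\<^sub>R (p x * cnj (p x)) = (\<Sum>m\<in>A. \<Sum>n\<in>A. (c m * cnj (c n)) * (?I x *\<^sub>R (e m x * cnj
      (e n x))))" for x
    unfolding p_def cnj_sum sum_product scaleR_sum_right
    by (intro sum.cong) (auto simp: scaleR_conv_of_real mult_ac)
  note orth = exponential_orthogonality[OF l]
  have ipp: "integrable lborel (\<lambda>x. ?I x *\<^sub>R (p x * cnj (p x)))"
    unfolding pp ee by (intro Bochner_Integration.integrable_sum integrable_mult_right orth(1))
  have "(LINT x|lborel. ?I x *\<^sub>R (p x * cnj (p x))) = (\<Sum>m\<in>A. \<Sum>n\<in>A. (c m * cnj (c n)) * (if m - n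
      = 0 then 2 * of_real l else 0))"
    unfolding pp ee
    by (subst Bochner_Integration.integral_sum, intro Bochner_Integration.integrable_sum
        integrable_mult_right orth(1),
      intro sum.cong refl, subst Bochner_Integration.integral_sum, intro integrable_mult_right orth(1))
     (simp only: integral_mult_right_zero orth(2))
  also have "\<dots> = (\<Sum>m\<in>A. c m * cnj (c m) * (2 * of_real l))"
    using A by (intro sum.cong refl) (simp add: if_distrib[of "(*) _"] sum.delta cong: if_cong)
  also have "\<dots> = of_real (2 * l * s)"
    unfolding s_def of_real_mult of_real_sum complex_norm_square sum_distrib_left
    by (intro sum.cong) (auto simp: mult_ac complex_norm_square[symmetric])
  finally have P: "(LINT x|lborel. ?I x *\<^sub>R (p x * cnj (p x))) = of_real (2 * l * s)" .
  have "(LINT x|lborel. 2 * Re (h x * cnj (p x)))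
      \<le> (LINT x|lborel. (cmod (h x))\<^sup>2 + Re (?I x *\<^sub>R (p x * cnj (p x))))"
  proof (rule integral_mono)
    show "integrable lborel (\<lambda>x. 2 * Re (h x * cnj (p x)))"
      by (rule integrable_mult_right[OF integrable_Re[OF ihp]])
    show "integrable lborel (\<lambda>x. (cmod (h x))\<^sup>2 + Re (?I x *\<^sub>R (p x * cnj (p x))))"
      using h2 integrable_Re[OF ipp] by (rule Bochner_Integration.integrable_add)
    fix x
    show "2 * Re (h x * cnj (p x)) \<le> (cmod (h x))\<^sup>2 + Re (?I x *\<^sub>R (p x * cnj (p x)))"
    proof (cases "x \<in> {-l..l}")
      case True
      have "0 \<le> (Re (h x) - Re (p x))\<^sup>2 + (Im (h x) - Im (p x))\<^sup>2" by simp
      then show ?thesis using True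
        unfolding cmod_power2 by (simp add: power2_eq_square algebra_simps)
    qed (use supp[of x] in \<open>auto simp: indicator_def\<close>)
  qed
  also have "\<dots> = (LINT x|lborel. (cmod (h x))\<^sup>2) + (LINT x|lborel. Re (?I x *\<^sub>R (p x * cnj (p x))))"
    using h2 integrable_Re[OF ipp] by (rule Bochner_Integration.integral_add)
  also have "(LINT x|lborel. Re (?I x *\<^sub>R (p x * cnj (p x)))) = 2 * l * s"
    unfolding integral_Re[OF ipp] P by simp
  also have "(LINT x|lborel. 2 * Re (h x * cnj (p x))) = 2 * (2 * l * s)"
    unfolding integral_mult_right_zero integral_Re[OF ihp] H by simp
  finally have "2 * l * s \<le> (LINT x|lborel. (cmod (h x))\<^sup>2)" by simp
  then show ?thesis
    unfolding s_def[symmetric] using l by (simp add: field_simps)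
qed

text \<open>
  The plane integral is the transform in \<open>y\<close> of the partial Fourier coefficients \<open>G m y\<close>.
  Plancherel in \<open>y\<close> for each mode, followed by Bessel in \<open>x\<close> for almost every \<open>y\<close>, gives
  the estimate.
\<close>
lemma fourier_energy_borel:
  fixes g :: "real \<times> real \<Rightarrow> complex"
  assumes l: "l > 0" and g: "g \<in> borel_measurable borel" and g1: "integrable lborel g"
    and g2: "integrable lborel (\<lambda>q. (cmod (g q))\<^sup>2)" and supp: "\<And>q. q \<notin> Strip l \<Longrightarrow> g q = 0"
    and A: "finite A"
  shows "(\<Sum>m\<in>A. \<integral>\<^sup>+ \<xi>. ennreal ((cmod (1 / (2 * of_real l) * (LINT q|lborel. g q * cnj
      (plane_wave l m \<xi> q))))\<^sup>2) \<partial>lborel)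
    \<le> ennreal (pi / l * (LINT q|lborel. (cmod (g q))\<^sup>2))"
proof -
  note [measurable] = g
  let ?x = "\<lambda>m x. exp (- \<i> * of_real (freq l * of_int m * x))"
  define G where "G m y = 1 / (2 * of_real l) * (LINT x|lborel. g (x, y) * ?x m x)" for m y
  define E where "E y = (LINT x|lborel. (cmod (g (x, y)))\<^sup>2)" for y
  have g1': "integrable (lborel \<Otimes>\<^sub>M lborel) (case_prod (\<lambda>x y. g (x, y)))"
    using g1 by (simp add: lborel_prod)
  have g2': "integrable (lborel \<Otimes>\<^sub>M lborel) (case_prod (\<lambda>x y. (cmod (g (x, y)))\<^sup>2))"
    using g2 by (simp add: lborel_prod case_prod_beta')
  have xb: "(\<lambda>q. ?x m (fst q)) \<in> borel_measurable borel" for m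
    by (intro borel_measurable_continuous_onI continuous_intros)
  have wb: "(\<lambda>q. cnj (plane_wave l m \<xi> q)) \<in> borel_measurable borel" for m \<xi>
    by measurable
  have gx: "integrable (lborel \<Otimes>\<^sub>M lborel) (case_prod (\<lambda>x y. g (x, y) * ?x m x))" for m
    unfolding lborel_prod
    by (rule Bochner_Integration.integrable_bound[OF g1]) 
      (use g xb[of m] in \<open>auto simp: case_prod_beta' norm_mult norm_exp_eq_Re intro!:
          borel_measurable_times\<close>)
  have gw: "integrable (lborel \<Otimes>\<^sub>M lborel) (case_prod (\<lambda>x y. g (x, y) * cnj (plane_wave l m \<xi>
      (x, y))))" for m \<xi>
    unfolding lborel_prod
    by (rule Bochner_Integration.integrable_bound[OF g1])
      (use g wb[of m \<xi>] in \<open>auto simp: case_prod_beta' norm_mult intro!: borel_measurable_times\<close>)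
  have G1: "integrable lborel (G m)" for m
    unfolding G_def[abs_def] by (intro integrable_mult_right lborel_pair.integrable_snd gx)
  have Gm[measurable]: "G m \<in> borel_measurable borel" for m
    using G1[of m] by auto
  have E1: "integrable lborel E"
    unfolding E_def[abs_def] by (rule lborel_pair.integrable_snd[OF g2'])
  have E0: "E y \<ge> 0" for y
    by (simp add: E_def)
  have bes: "AE y in lborel. \<forall>B. finite B \<longrightarrow> (\<Sum>m\<in>B. (cmod (G m y))\<^sup>2) \<le> 1 / (2 * l) * E y"
    using lborel_pair.AE_integrable_snd[OF g1'] lborel_pair.AE_integrable_snd[OF g2']
  proof eventually_elim
    fix y assume "integrable lborel (\<lambda>x. g (x, y))" "integrable lborel (\<lambda>x. (cmod (g (x, y)))\<^sup>2)"
    from bessel_inequality[OF l this] show "\<forall>B. finite B \<longrightarrow> (\<Sum>m\<in>B. (cmod (G m y))\<^sup>2) \<le> 1 / (2 * l) * E y"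
      using supp by (auto simp: G_def E_def Strip_def)
  qed
  have G2: "integrable lborel (\<lambda>y. (cmod (G m y))\<^sup>2)" for m
  proof (rule Bochner_Integration.integrable_bound)
    show "integrable lborel (\<lambda>y. 1 / (2 * l) * E y)" using E1 by simp
    show "AE y in lborel. norm ((cmod (G m y))\<^sup>2) \<le> norm (1 / (2 * l) * E y)"
      using bes by eventually_elim (drule spec[of _ "{m}"], use E0 l in auto)
  qed measurable
  have tr: "1 / (2 * of_real l) * (LINT q|lborel. g q * cnj (plane_wave l m \<xi> q))
      = (LINT y|lborel. G m y * exp (- \<i> * of_real (\<xi> * y)))" for m \<xi>
  proof -
    have "(LINT q|lborel. g q * cnj (plane_wave l m \<xi> q))
        = (LINT y|lborel. LINT x|lborel. g (x, y) * cnj (plane_wave l m \<xi> (x, y)))"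
      using lborel_pair.integral_snd[OF gw[of m \<xi>]] by (simp add: lborel_prod case_prod_beta')
    also have "\<dots> = (LINT y|lborel. LINT x|lborel. (g (x, y) * ?x m x) * exp (- \<i> * of_real (\<xi> * y)))"
      by (simp add: cnj_plane_wave exp_diff exp_minus divide_inverse mult_ac)
    also have "\<dots> = (LINT y|lborel. (LINT x|lborel. g (x, y) * ?x m x) * exp (- \<i> * of_real (\<xi> * y)))"
      by (simp only: integral_mult_left_zero)
    finally have "1 / (2 * of_real l) * (LINT q|lborel. g q * cnj (plane_wave l m \<xi> q)) = 
        (LINT y|lborel. 1 / (2 * of_real l) * ((LINT x|lborel. g (x, y) * ?x m x) * exp
            (- \<i> * of_real (\<xi> * y))))"
      by (simp only: integral_mult_right_zero)
    then show ?thesis by (simp only: G_def mult.assoc)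
  qed
  have "(\<Sum>m\<in>A. \<integral>\<^sup>+ \<xi>. ennreal ((cmod (1 / (2 * of_real l) * (LINT q|lborel. g q * cnj
      (plane_wave l m \<xi> q))))\<^sup>2) \<partial>lborel)
    \<le> (\<Sum>m\<in>A. ennreal (2 * pi * (LINT y|lborel. (cmod (G m y))\<^sup>2)))"
    unfolding tr by (intro sum_mono plancherel_inequality G1 G2)
  also have "\<dots> = ennreal (\<Sum>m\<in>A. 2 * pi * (LINT y|lborel. (cmod (G m y))\<^sup>2))"
    by (rule sum_ennreal) simp
  also have "\<dots> \<le> ennreal (pi / l * (LINT q|lborel. (cmod (g q))\<^sup>2))"
  proof (rule ennreal_leI)
    have "(\<Sum>m\<in>A. 2 * pi * (LINT y|lborel. (cmod (G m y))\<^sup>2))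
        = 2 * pi * (LINT y|lborel. (\<Sum>m\<in>A. (cmod (G m y))\<^sup>2))"
      using G2 by (subst Bochner_Integration.integral_sum) (auto simp: sum_distrib_left)
    also have "(LINT y|lborel. (\<Sum>m\<in>A. (cmod (G m y))\<^sup>2)) \<le> (LINT y|lborel. 1 / (2 * l) * E y)"
      using G2 E1 bes A by (intro integral_mono_AE) (auto elim!: eventually_mono)
    also have "\<dots> = 1 / (2 * l) * (LINT q|lborel. (cmod (g q))\<^sup>2)"
      unfolding E_def integral_mult_right_zero
      using lborel_pair.integral_snd[OF g2'] by (simp add: lborel_prod case_prod_beta')
    finally show "(\<Sum>m\<in>A. 2 * pi * (LINT y|lborel. (cmod (G m y))\<^sup>2))
        \<le> pi / l * (LINT q|lborel. (cmod (g q))\<^sup>2)"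
      by (simp add: field_simps)
  qed
  finally show ?thesis .
qed

lemma
  assumes l: "l > 0" and f1: "integrable (lebesgue_on (Strip l)) f"
  shows borel_measurable_fourier [measurable]: "fourier l f m \<in> borel_measurable borel"
    and fourier_energy: "integrable (lebesgue_on (Strip l)) (\<lambda>q. (cmod (f q))\<^sup>2) \<Longrightarrow> finite A \<Longrightarrow>
      (\<Sum>m\<in>A. \<integral>\<^sup>+ \<xi>. ennreal ((cmod (fourier l f m \<xi>))\<^sup>2) \<partial>lborel)
      \<le> ennreal (pi / l * (LINT q|lebesgue_on (Strip l). (cmod (f q))\<^sup>2))"
proof -
  have f1': "integrable lebesgue (\<lambda>q. indicator (Strip l) q *\<^sub>R f q)"
    using f1 by (simp add: integrable_restrict_space)
  obtain g0 where g0: "g0 \<in> borel_measurable borel" and ae0: "AE q in lborel. indicator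
      (Strip l) q *\<^sub>R f q = g0 q"
    using lebesgue_borel_version[OF borel_measurable_integrable[OF f1']] by metis
  define g where "g q = indicator (Strip l) q *\<^sub>R g0 q" for q
  have g[measurable]: "g \<in> borel_measurable borel"
    unfolding g_def[abs_def] using g0 by measurable
  have supp: "g q = 0" if "q \<notin> Strip l" for q using that by (simp add: g_def)
  have ae: "AE q in lebesgue. indicator (Strip l) q *\<^sub>R f q = g q"
    using AE_completion[OF ae0] by eventually_elim (auto simp: g_def indicator_def split: if_splits)
  have gl: "g \<in> borel_measurable lebesgue"
    by (rule measurable_completion) simp
  have g1l: "integrable lebesgue g"
    by (rule integrable_cong_AE_imp[OF f1' gl]) (use ae in \<open>simp add: eq_commute\<close>)
  then have g1: "integrable lborel g" by (simp add: integrable_completion)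
  have four: "fourier l f m \<xi> = 1 / (2 * of_real l) * (LINT q|lborel. g q * cnj
      (plane_wave l m \<xi> q))" for m \<xi>
  proof -
    let ?w = "\<lambda>q. cnj (plane_wave l m \<xi> q)"
    have w: "?w \<in> borel_measurable lebesgue"
      by (rule measurable_completion) simp
    have "(LINT q|lebesgue_on (Strip l). f q * ?w q)
        = (LINT q|lebesgue. (indicator (Strip l) q *\<^sub>R f q) * ?w q)"
      by (simp add: integral_restrict_space)
    also have "\<dots> = (LINT q|lebesgue. g q * ?w q)"
    proof (rule integral_cong_AE)
      show "(\<lambda>q. (indicator (Strip l) q *\<^sub>R f q) * ?w q) \<in> borel_measurable lebesgue"
        by (rule borel_measurable_times[OF borel_measurable_integrable[OF f1'] w])
      show "(\<lambda>q. g q * ?w q) \<in> borel_measurable lebesgue"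
        by (rule borel_measurable_times[OF gl w])
      show "AE q in lebesgue. (indicator (Strip l) q *\<^sub>R f q) * ?w q = g q * ?w q"
        using ae by eventually_elim simp
    qed
    also have "\<dots> = (LINT q|lborel. g q * ?w q)"
      by (rule integral_completion) measurable
    finally show ?thesis using fourier_eq_plane_integral[OF f1] by simp
  qed
  have pw: "(\<lambda>p. cnj (plane_wave l m (fst p) (snd p))) \<in> borel_measurable borel"
    unfolding plane_wave_def by (intro borel_measurable_continuous_onI continuous_intros)
  have "(\<lambda>\<xi>. LINT q|lborel. g q * cnj (plane_wave l m \<xi> q)) \<in> borel_measurable lborel"
  proof (rule lborel.borel_measurable_lebesgue_integral)
    have "(\<lambda>p. g (snd p)) \<in> borel_measurable (borel :: (real \<times> real \<times> real) measure)"
      by (rule measurable_compose[OF borel_measurable_continuous_onI g]) (intro continuous_intros)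
    then have "(\<lambda>p. g (snd p) * cnj (plane_wave l m (fst p) (snd p))) \<in> borel_measurable
        (borel \<Otimes>\<^sub>M borel)"
      using pw unfolding borel_prod by (rule borel_measurable_times)
    then show "(\<lambda>(\<xi>, q). g q * cnj (plane_wave l m \<xi> q)) \<in> borel_measurable (lborel \<Otimes>\<^sub>M lborel)"
      by (simp add: case_prod_beta' cong: measurable_cong_sets sets_pair_measure_cong)
  qed
  then show "fourier l f m \<in> borel_measurable borel"
    unfolding four[abs_def] by simp
  assume f2: "integrable (lebesgue_on (Strip l)) (\<lambda>q. (cmod (f q))\<^sup>2)" and A: "finite A"
  have f2': "integrable lebesgue (\<lambda>q. indicator (Strip l) q *\<^sub>R (cmod (f q))\<^sup>2)"
    using f2 by (simp add: integrable_restrict_space)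
  have ae2: "AE q in lebesgue. indicator (Strip l) q *\<^sub>R (cmod (f q))\<^sup>2 = (cmod (g q))\<^sup>2"
    using ae by eventually_elim (auto simp: indicator_def)
  have gl2: "(\<lambda>q. (cmod (g q))\<^sup>2) \<in> borel_measurable lebesgue"
    by (rule measurable_completion) simp
  have g2l: "integrable lebesgue (\<lambda>q. (cmod (g q))\<^sup>2)"
    by (rule integrable_cong_AE_imp[OF f2' gl2]) (use ae2 in \<open>simp add: eq_commute\<close>)
  then have g2: "integrable lborel (\<lambda>q. (cmod (g q))\<^sup>2)"
    by (subst (asm) integrable_completion) auto
  have "(LINT q|lborel. (cmod (g q))\<^sup>2) = (LINT q|lebesgue. (cmod (g q))\<^sup>2)"
    by (rule integral_completion[symmetric]) simp
  also have "\<dots> = (LINT q|lebesgue. indicator (Strip l) q *\<^sub>R (cmod (f q))\<^sup>2)"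
    by (rule integral_cong_AE[OF gl2 borel_measurable_integrable[OF f2']])
        (use ae2 in \<open>simp add: eq_commute\<close>)
  also have "\<dots> = (LINT q|lebesgue_on (Strip l). (cmod (f q))\<^sup>2)"
    by (simp add: integral_restrict_space)
  finally show "(\<Sum>m\<in>A. \<integral>\<^sup>+ \<xi>. ennreal ((cmod (fourier l f m \<xi>))\<^sup>2) \<partial>lborel)
      \<le> ennreal (pi / l * (LINT q|lebesgue_on (Strip l). (cmod (f q))\<^sup>2))"
    unfolding four using fourier_energy_borel[OF l g g1 g2 _ A] supp by simp
qed

section \<open>Fourier multipliers with square-integrable symbols\<close>

text \<open>
  The symbol \<open>q\<close> has norm at most \<open>sqrt S\<close> in \<open>L\<^sup>2\<close> of the nonzero integers times the
  line. Nonnegative integrals express square integrability and the bound at once.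
\<close>
definition square_bounded :: "real \<Rightarrow> (int \<Rightarrow> real \<Rightarrow> complex) \<Rightarrow> bool" where
  "square_bounded S q \<longleftrightarrow> 0 \<le> S \<and> (\<forall>m. q m \<in> borel_measurable borel) \<and>
     (\<forall>A. finite A \<and> 0 \<notin> A \<longrightarrow> (\<Sum>m\<in>A. \<integral>\<^sup>+ \<xi>. ennreal ((cmod (q m \<xi>))\<^sup>2) \<partial>lborel) \<le> ennreal S)"

definition in_L1_L2 :: "real \<Rightarrow> (real \<times> real \<Rightarrow> complex) \<Rightarrow> bool" where
  "in_L1_L2 l f \<longleftrightarrow> integrable (lebesgue_on (Strip l)) f \<and>
     integrable (lebesgue_on (Strip l)) (\<lambda>q. (cmod (f q))\<^sup>2)"

definition energy :: "real \<Rightarrow> (real \<times> real \<Rightarrow> complex) \<Rightarrow> real" where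
  "energy l f = (LINT q|lebesgue_on (Strip l). (cmod (f q))\<^sup>2)"

text \<open>
  This is the right-hand side of the integral equation without the constant \<open>1\<close>, for an
  arbitrary symbol \<open>q\<close> in place of \<open>1 / P\<close> and an arbitrary source \<open>f\<close> in place of \<open>u \<nu>\<close>.
\<close>
definition multiplier :: "real \<Rightarrow> (int \<Rightarrow> real \<Rightarrow> complex) \<Rightarrow>
    (real \<times> real \<Rightarrow> complex) \<Rightarrow> real \<times> real \<Rightarrow> complex" where
  "multiplier l q f p = 1 / (2 * of_real pi) *
     (\<Sum>\<^sub>\<infinity>m\<in>UNIV - {0}. LINT \<xi>|lebesgue. fourier l f m \<xi> * q m \<xi> * plane_wave l m \<xi> p)"

text \<open>
  Cauchy--Schwarz twice: in the frequency for each index, then in the index.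
\<close>
lemma Cauchy_Schwarz_families:
  fixes \<phi> \<psi> :: "'i \<Rightarrow> real \<Rightarrow> complex"
  assumes [measurable]: "\<And>m. \<phi> m \<in> borel_measurable borel" "\<And>m. \<psi> m \<in> borel_measurable borel"
    and A: "finite A" and E: "0 \<le> E" and S: "0 \<le> S"
    and \<phi>: "(\<Sum>m\<in>A. \<integral>\<^sup>+ \<xi>. ennreal ((cmod (\<phi> m \<xi>))\<^sup>2) \<partial>lborel) \<le> ennreal E"
    and \<psi>: "(\<Sum>m\<in>A. \<integral>\<^sup>+ \<xi>. ennreal ((cmod (\<psi> m \<xi>))\<^sup>2) \<partial>lborel) \<le> ennreal S"
  shows "\<And>m. m \<in> A \<Longrightarrow> integrable lborel (\<lambda>\<xi>. \<phi> m \<xi> * \<psi> m \<xi>)"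
    and "(\<Sum>m\<in>A. LINT \<xi>|lborel. cmod (\<phi> m \<xi> * \<psi> m \<xi>)) \<le> sqrt E * sqrt S"
proof -
  define a b where "a m = (\<integral>\<^sup>+ \<xi>. ennreal ((cmod (\<phi> m \<xi>))\<^sup>2) \<partial>lborel)" and "b m
      = (\<integral>\<^sup>+ \<xi>. ennreal ((cmod (\<psi> m \<xi>))\<^sup>2) \<partial>lborel)" for m
  define N where "N m = (\<integral>\<^sup>+ \<xi>. ennreal (cmod (\<phi> m \<xi> * \<psi> m \<xi>)) \<partial>lborel)" for m
  have fa: "a m < top" if "m \<in> A" for m
    using member_le_sum[OF that, of a] A \<phi> by (auto simp: a_def[symmetric] intro: le_less_trans[OF
        order_trans])
  have fb: "b m < top" if "m \<in> A" for m
    using member_le_sum[OF that, of b] A \<psi> by (auto simp: b_def[symmetric] intro: le_less_trans[OF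
        order_trans])
  have CS: "(N m)\<^sup>2 \<le> a m * b m" for m
    using Cauchy_Schwarz_nn_integral[of "\<lambda>\<xi>. ennreal (cmod (\<phi> m \<xi>))" lborel "\<lambda>\<xi>. ennreal (cmod
        (\<psi> m \<xi>))"]
    by (simp add: N_def a_def b_def norm_mult ennreal_mult ennreal_power)
  have fN: "N m < top" if "m \<in> A" for m
  proof (rule ccontr)
    \<comment> \<open>The real-valued integral is \<open>0\<close> when divergent, so finiteness must be settled before leaving
        \<open>ennreal\<close>.\<close>
    assume "\<not> N m < top"
    then have "(N m)\<^sup>2 = top" by (simp add: top.not_eq_extremum[symmetric] power2_eq_square
        ennreal_mult_eq_top_iff)
    then have "a m * b m = top" using CS[of m] by (simp add: top_unique)
    then show False using fa[OF that] fb[OF that] by (auto simp: ennreal_mult_eq_top_iff)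
  qed
  show int: "integrable lborel (\<lambda>\<xi>. \<phi> m \<xi> * \<psi> m \<xi>)" if "m \<in> A" for m
    using fN[OF that] by (intro integrableI_bounded) (auto simp: N_def)
  define \<alpha> \<beta> where "\<alpha> m = enn2real (a m)" and "\<beta> m = enn2real (b m)" for m
  have \<alpha>: "a m = ennreal (\<alpha> m)" "0 \<le> \<alpha> m" if "m \<in> A" for m using fa[OF that] by (auto simp: \<alpha>_def)
  have \<beta>: "b m = ennreal (\<beta> m)" "0 \<le> \<beta> m" if "m \<in> A" for m using fb[OF that] by (auto simp: \<beta>_def)
  have one: "(LINT \<xi>|lborel. cmod (\<phi> m \<xi> * \<psi> m \<xi>)) \<le> sqrt (\<alpha> m) * sqrt (\<beta> m)" if m: "m \<in> A" for m
  proof -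
    let ?I = "LINT \<xi>|lborel. cmod (\<phi> m \<xi> * \<psi> m \<xi>)"
    have I0: "0 \<le> ?I" by simp
    have "N m = ennreal ?I"
      unfolding N_def using int[OF m] by (intro nn_integral_eq_integral) auto
    then have "ennreal (?I\<^sup>2) \<le> ennreal (\<alpha> m * \<beta> m)"
      using CS[of m] \<alpha>[OF m] \<beta>[OF m] I0 by (simp add: ennreal_power ennreal_mult)
    then have "?I\<^sup>2 \<le> \<alpha> m * \<beta> m"
      using \<alpha>[OF m] \<beta>[OF m] by (subst (asm) ennreal_le_iff) auto
    then show ?thesis
      unfolding real_sqrt_mult[symmetric] by (rule real_le_rsqrt)
  qed
  have "(\<Sum>m\<in>A. LINT \<xi>|lborel. cmod (\<phi> m \<xi> * \<psi> m \<xi>)) \<le> (\<Sum>m\<in>A. \<bar>sqrt (\<alpha> m)\<bar> * \<bar>sqrt (\<beta> m)\<bar>)"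
    using one \<alpha>(2) \<beta>(2) by (intro sum_mono) simp
  also have "\<dots> \<le> L2_set (\<lambda>m. sqrt (\<alpha> m)) A * L2_set (\<lambda>m. sqrt (\<beta> m)) A"
    by (rule L2_set_mult_ineq)
  also have "\<dots> = sqrt (sum \<alpha> A) * sqrt (sum \<beta> A)"
    unfolding L2_set_def using \<alpha>(2) \<beta>(2) by (simp cong: sum.cong)
  also have "\<dots> \<le> sqrt E * sqrt S"
  proof (intro mult_mono real_sqrt_le_mono)
    have "ennreal (sum \<alpha> A) = (\<Sum>m\<in>A. a m)" using \<alpha> by (subst sum_ennreal[symmetric]) auto
    then show "sum \<alpha> A \<le> E" using \<phi> E unfolding a_def[symmetric] by (metis ennreal_le_iff)
    have "ennreal (sum \<beta> A) = (\<Sum>m\<in>A. b m)" using \<beta> by (subst sum_ennreal[symmetric]) auto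
    then show "sum \<beta> A \<le> S" using \<psi> S unfolding b_def[symmetric] by (metis ennreal_le_iff)
  qed (use \<alpha>(2) \<beta>(2) E in \<open>auto intro: sum_nonneg\<close>)
  finally show "(\<Sum>m\<in>A. LINT \<xi>|lborel. cmod (\<phi> m \<xi> * \<psi> m \<xi>)) \<le> sqrt E * sqrt S" .
qed

lemma energy_nonneg [simp]: "0 \<le> energy l f"
  by (simp add: energy_def)

lemma in_L1_L2_cmult:
  assumes "in_L1_L2 l f" shows "in_L1_L2 l (\<lambda>p. c * f p)"
  using assms by (auto simp: in_L1_L2_def norm_mult power_mult_distrib)

lemma in_L1_L2_diff:
  assumes "in_L1_L2 l f" "in_L1_L2 l g"
  shows "in_L1_L2 l (\<lambda>p. f p - g p)"
proof -
  let ?M = "lebesgue_on (Strip l)"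
  have i: "integrable ?M f" "integrable ?M g" "integrable ?M (\<lambda>q. (cmod (f q))\<^sup>2)" "integrable ?M
      (\<lambda>q. (cmod (g q))\<^sup>2)"
    using assms by (auto simp: in_L1_L2_def)
  then have d: "integrable ?M (\<lambda>p. f p - g p)" by simp
  have "integrable ?M (\<lambda>p. (cmod (f p - g p))\<^sup>2)"
  proof (rule Bochner_Integration.integrable_bound)
    show "integrable ?M (\<lambda>q. 2 * (cmod (f q))\<^sup>2 + 2 * (cmod (g q))\<^sup>2)" using i by simp
    show "(\<lambda>p. (cmod (f p - g p))\<^sup>2) \<in> borel_measurable ?M"
      using borel_measurable_integrable[OF d] by measurable
    have "(cmod (f q - g q))\<^sup>2 \<le> 2 * (cmod (f q))\<^sup>2 + 2 * (cmod (g q))\<^sup>2" for q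
    proof -
      have "(cmod (f q - g q))\<^sup>2 \<le> (cmod (f q) + cmod (g q))\<^sup>2"
        by (intro power_mono norm_triangle_ineq4) auto
      also have "\<dots> \<le> 2 * (cmod (f q))\<^sup>2 + 2 * (cmod (g q))\<^sup>2"
        using sum_squares_bound[of "cmod (f q)" "cmod (g q)"] by (simp add: power2_sum)
      finally show ?thesis .
    qed
    then show "AE q in ?M. norm ((cmod (f q - g q))\<^sup>2) \<le> norm (2 * (cmod (f q))\<^sup>2 + 2 * (cmod (g q))\<^sup>2)"
      by simp
  qed
  with d show ?thesis by (simp add: in_L1_L2_def)
qed

lemma plane_wave_borel_freq [measurable]: "(\<lambda>\<xi>. plane_wave l m \<xi> p) \<in> borel_measurable borel"
  unfolding plane_wave_def by (intro borel_measurable_continuous_onI continuous_intros)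

lemma plane_wave_add: "plane_wave l m \<xi> (p + p') = plane_wave l m \<xi> p * plane_wave l m \<xi> p'"
  by (simp add: plane_wave_def exp_add[symmetric] algebra_simps)

context
  fixes l :: real and f :: "real \<times> real \<Rightarrow> complex" and q :: "int \<Rightarrow> real \<Rightarrow> complex" and S :: real
  assumes l: "l > 0" and f: "in_L1_L2 l f" and q: "square_bounded S q"
begin

text \<open>
  The Cauchy--Schwarz inequality on the product of modes and frequencies makes all
  integrals and sums in the multiplier absolutely convergent and bounds its value at every
  single point of the plane.
\<close>
lemma multiplier_bounds:
  shows "m \<noteq> 0 \<Longrightarrow> integrable lborel (\<lambda>\<xi>. fourier l f m \<xi> * q m \<xi> * plane_wave l m \<xi> p)"
    and "m \<noteq> 0 \<Longrightarrow> integrable lebesgue (\<lambda>\<xi>. fourier l f m \<xi> * q m \<xi> * plane_wave l m \<xi> p)"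
    and "(\<lambda>m. LINT \<xi>|lebesgue. fourier l f m \<xi> * q m \<xi> * plane_wave l m \<xi> p) summable_on (UNIV - {0})"
    and "cmod (multiplier l q f p) \<le> 1 / (2 * pi) * (sqrt (pi / l * S) * sqrt (energy l f))"
proof -
  have [measurable]: "q m \<in> borel_measurable borel" for m
    using q by (simp add: square_bounded_def)
  have f1: "integrable (lebesgue_on (Strip l)) f" and f2: "integrable (lebesgue_on (Strip l)) (\<lambda>q.
      (cmod (f q))\<^sup>2)"
    using f by (auto simp: in_L1_L2_def)
  note [measurable] = borel_measurable_fourier[OF l f1]
  let ?E = "pi / l * energy l f"
  have E0: "0 \<le> ?E" and S0: "0 \<le> S" using l q by (auto simp: square_bounded_def)
  have w: "cmod (q m \<xi> * plane_wave l m \<xi> p) = cmod (q m \<xi>)" for m \<xi> by (simp add: norm_mult)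
  have wm: "(\<lambda>\<xi>. q m \<xi> * plane_wave l m \<xi> p) \<in> borel_measurable borel" for m by measurable
  have Q: "(\<Sum>m\<in>A. \<integral>\<^sup>+ \<xi>. ennreal ((cmod (q m \<xi> * plane_wave l m \<xi> p))\<^sup>2) \<partial>lborel)
      \<le> ennreal S" if "finite A" "0 \<notin> A" for A
    using q that by (simp add: square_bounded_def w)
  note CS = Cauchy_Schwarz_families[OF borel_measurable_fourier[OF l f1] wm _ E0 S0
     fourier_energy[OF l f1 f2, folded energy_def] Q]
  let ?t = "\<lambda>m \<xi>. fourier l f m \<xi> * q m \<xi> * plane_wave l m \<xi> p"
  show i: "integrable lborel (?t m)" if "m \<noteq> 0" for m
    using CS(1)[of "{m}" m] that by (simp add: mult.assoc)
  show i': "integrable lebesgue (?t m)" if "m \<noteq> 0" for m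
    by (subst integrable_completion) (use i[OF that] in auto)
  let ?T = "\<lambda>m. LINT \<xi>|lebesgue. ?t m \<xi>"
  have T: "?T m = (LINT \<xi>|lborel. ?t m \<xi>)" for m
    by (rule integral_completion) measurable
  have fin: "(\<Sum>m\<in>A. norm (?T m)) \<le> sqrt ?E * sqrt S" if "finite A" "A \<subseteq> UNIV - {0}" for A
  proof -
    have "(\<Sum>m\<in>A. norm (?T m)) \<le> (\<Sum>m\<in>A. LINT \<xi>|lborel. cmod (fourier l f m \<xi> *
        (q m \<xi> * plane_wave l m \<xi> p)))"
      unfolding T unfolding mult.assoc by (intro sum_mono integral_norm_bound)
    also have "\<dots> \<le> sqrt ?E * sqrt S"
      using that by (intro CS(2)) auto
    finally show ?thesis .
  qed
  have abs: "(\<lambda>m. norm (?T m)) summable_on (UNIV - {0})"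
    by (rule nonneg_bdd_above_summable_on) (auto intro!: bdd_aboveI2[where M="sqrt ?E * sqrt S"] fin)
  then show "?T summable_on (UNIV - {0})"
    by (rule abs_summable_summable)
  have "norm (\<Sum>\<^sub>\<infinity>m\<in>UNIV - {0}. ?T m) \<le> (\<Sum>\<^sub>\<infinity>m\<in>UNIV - {0}. norm (?T m))"
    by (rule norm_infsum_bound[OF abs])
  also have "\<dots> \<le> sqrt ?E * sqrt S"
    by (rule infsum_le_finite_sums[OF abs]) (rule fin)
  also have "\<dots> = sqrt (pi / l * S) * sqrt (energy l f)"
    by (simp add: real_sqrt_mult[symmetric] mult_ac)
  finally show "cmod (multiplier l q f p) \<le> 1 / (2 * pi) * (sqrt (pi / l * S) * sqrt (energy l f))"
    by (simp add: multiplier_def norm_mult norm_divide divide_right_mono)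
qed

end

lemma fourier_cmult:
  assumes "l > 0" "in_L1_L2 l f"
  shows "fourier l (\<lambda>p. c * f p) m \<xi> = c * fourier l f m \<xi>"
  using assms in_L1_L2_cmult[OF assms(2), of c]
  by (simp add: fourier_eq_plane_integral in_L1_L2_def mult.assoc)

lemma fourier_diff:
  assumes "l > 0" "in_L1_L2 l f" "in_L1_L2 l g"
  shows "fourier l (\<lambda>p. f p - g p) m \<xi> = fourier l f m \<xi> - fourier l g m \<xi>"
proof -
  have w: "integrable (lebesgue_on (Strip l)) (\<lambda>q. f q * cnj (plane_wave l m \<xi> q))"
    if "in_L1_L2 l f" for f
  proof (rule Bochner_Integration.integrable_bound)
    show i: "integrable (lebesgue_on (Strip l)) f" using that by (simp add: in_L1_L2_def)
    show "(\<lambda>q. f q * cnj (plane_wave l m \<xi> q)) \<in> borel_measurable (lebesgue_on (Strip l))"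
      by (intro borel_measurable_times borel_measurable_integrable[OF i] borel_imp_lebesgue_on
          cnj_plane_wave_borel)
  qed (simp add: norm_mult)
  show ?thesis
    using assms in_L1_L2_diff[OF assms(2,3)] w[OF assms(2)] w[OF assms(3)]
    by (simp add: fourier_eq_plane_integral in_L1_L2_def left_diff_distrib right_diff_distrib
        diff_divide_distrib)
qed

lemma infsum_diff_complex:
  fixes f g :: "'i \<Rightarrow> complex"
  assumes "f summable_on A" "g summable_on A"
  shows "(\<Sum>\<^sub>\<infinity>i\<in>A. f i - g i) = infsum f A - infsum g A"
proof -
  have "((\<lambda>i. - g i) has_sum - infsum g A) A"
    using has_sum_infsum[OF assms(2)] by (subst has_sum_uminus) simp
  from has_sum_add[OF has_sum_infsum[OF assms(1)] this] show ?thesis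
    by (intro infsumI) simp
qed

lemma multiplier_cmult:
  assumes "l > 0" "in_L1_L2 l f"
  shows "multiplier l q (\<lambda>p. c * f p) p = c * multiplier l q f p"
proof -
  have "(LINT \<xi>|lebesgue. c * fourier l f m \<xi> * q m \<xi> * plane_wave l m \<xi> p)
    = c * (LINT \<xi>|lebesgue. fourier l f m \<xi> * q m \<xi> * plane_wave l m \<xi> p)" for m
    by (simp only: mult.assoc integral_mult_right_zero)
  then show ?thesis
    unfolding multiplier_def fourier_cmult[OF assms] by (simp add: infsum_cmult_right')
qed

lemma multiplier_diff:
  assumes l: "l > 0" and f: "in_L1_L2 l f" and g: "in_L1_L2 l g" and q: "square_bounded S q"
  shows "multiplier l q (\<lambda>p. f p - g p) p = multiplier l q f p - multiplier l q g p"
proof -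
  note F = multiplier_bounds[OF l f q] and G = multiplier_bounds[OF l g q]
  have "(\<Sum>\<^sub>\<infinity>m\<in>UNIV - {0}. LINT \<xi>|lebesgue. fourier l (\<lambda>p. f p - g p) m \<xi> * q m \<xi> * plane_wave l m \<xi> p)
    = (\<Sum>\<^sub>\<infinity>m\<in>UNIV - {0}. (LINT \<xi>|lebesgue. fourier l f m \<xi> * q m \<xi> * plane_wave l m \<xi> p)
      - (LINT \<xi>|lebesgue. fourier l g m \<xi> * q m \<xi> * plane_wave l m \<xi> p))"
    by (intro infsum_cong) (simp add: fourier_diff[OF l f g] left_diff_distrib F(2) G(2))
  also have "\<dots> = (\<Sum>\<^sub>\<infinity>m\<in>UNIV - {0}. LINT \<xi>|lebesgue. fourier l f m \<xi> * q m \<xi> * plane_wave l m \<xi> p)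
      - (\<Sum>\<^sub>\<infinity>m\<in>UNIV - {0}. LINT \<xi>|lebesgue. fourier l g m \<xi> * q m \<xi> * plane_wave l m \<xi> p)"
    by (rule infsum_diff_complex[OF F(3) G(3)])
  finally show ?thesis by (simp add: multiplier_def diff_divide_distrib)
qed

lemma multiplier_symbol_cmult: "multiplier l (\<lambda>m \<xi>. c * q m \<xi>) f p = c * multiplier l q f p"
proof -
  have "(LINT \<xi>|lebesgue. fourier l f m \<xi> * (c * q m \<xi>) * plane_wave l m \<xi> p)
    = c * (LINT \<xi>|lebesgue. fourier l f m \<xi> * q m \<xi> * plane_wave l m \<xi> p)" for m
    by (subst integral_mult_right_zero[symmetric]) (simp add: mult_ac)
  then show ?thesis
    unfolding multiplier_def by (simp add: infsum_cmult_right')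
qed

lemma multiplier_symbol_diff:
  assumes l: "l > 0" and f: "in_L1_L2 l f" and q: "square_bounded S q" and r: "square_bounded R r"
  shows "multiplier l (\<lambda>m \<xi>. q m \<xi> - r m \<xi>) f p = multiplier l q f p - multiplier l r f p"
proof -
  note F = multiplier_bounds[OF l f q] and G = multiplier_bounds[OF l f r]
  have "(\<Sum>\<^sub>\<infinity>m\<in>UNIV - {0}. LINT \<xi>|lebesgue. fourier l f m \<xi> * (q m \<xi> - r m \<xi>) * plane_wave l m \<xi> p)
    = (\<Sum>\<^sub>\<infinity>m\<in>UNIV - {0}. (LINT \<xi>|lebesgue. fourier l f m \<xi> * q m \<xi> * plane_wave l m \<xi> p)
      - (LINT \<xi>|lebesgue. fourier l f m \<xi> * r m \<xi> * plane_wave l m \<xi> p))"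
    by (intro infsum_cong) (simp add: right_diff_distrib left_diff_distrib F(2) G(2))
  also have "\<dots> = (\<Sum>\<^sub>\<infinity>m\<in>UNIV - {0}. LINT \<xi>|lebesgue. fourier l f m \<xi> * q m \<xi> * plane_wave l m \<xi> p)
      - (\<Sum>\<^sub>\<infinity>m\<in>UNIV - {0}. LINT \<xi>|lebesgue. fourier l f m \<xi> * r m \<xi> * plane_wave l m \<xi> p)"
    by (rule infsum_diff_complex[OF F(3) G(3)])
  finally show ?thesis by (simp add: multiplier_def diff_divide_distrib)
qed

text \<open>
  A translation acts on the symbol. Through this, continuity of the image function becomes
  smallness of a symbol.
\<close>
lemma multiplier_translate:
  "multiplier l q f (p + h) = multiplier l (\<lambda>m \<xi>. q m \<xi> * plane_wave l m \<xi> h) f p"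
  unfolding multiplier_def by (simp add: plane_wave_add mult_ac)

text \<open>
  All symbols that occur later are compared with \<open>1 / P\<close> at one fixed parameter.
\<close>
lemma square_bounded_dominated:
  assumes q: "square_bounded S q" and r: "\<And>m. r m \<in> borel_measurable borel" and B: "0 \<le> B"
    and le: "\<And>m \<xi>. m \<noteq> 0 \<Longrightarrow> cmod (r m \<xi>) \<le> B * cmod (q m \<xi>)"
  shows "square_bounded (B\<^sup>2 * S) r"
  unfolding square_bounded_def
proof (intro conjI allI impI r)
  have S: "0 \<le> S" and [measurable]: "\<And>m. q m \<in> borel_measurable borel"
    using q by (auto simp: square_bounded_def)
  then show "0 \<le> B\<^sup>2 * S" by simp
  fix A :: "int set" assume A: "finite A \<and> 0 \<notin> A"
  have "(\<Sum>m\<in>A. \<integral>\<^sup>+ \<xi>. ennreal ((cmod (r m \<xi>))\<^sup>2) \<partial>lborel)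
    \<le> (\<Sum>m\<in>A. \<integral>\<^sup>+ \<xi>. ennreal (B\<^sup>2) * ennreal ((cmod (q m \<xi>))\<^sup>2) \<partial>lborel)"
  proof (intro sum_mono nn_integral_mono)
    fix m \<xi> assume "m \<in> A"
    then have "(cmod (r m \<xi>))\<^sup>2 \<le> (B * cmod (q m \<xi>))\<^sup>2"
      using A by (intro power_mono le) auto
    then show "ennreal ((cmod (r m \<xi>))\<^sup>2) \<le> ennreal (B\<^sup>2) * ennreal ((cmod (q m \<xi>))\<^sup>2)"
      by (simp add: ennreal_mult[symmetric] power_mult_distrib ennreal_leI)
  qed
  also have "\<dots> = ennreal (B\<^sup>2) * (\<Sum>m\<in>A. \<integral>\<^sup>+ \<xi>. ennreal ((cmod (q m \<xi>))\<^sup>2) \<partial>lborel)"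
    by (simp add: nn_integral_cmult sum_distrib_left)
  also have "\<dots> \<le> ennreal (B\<^sup>2) * ennreal S"
    using q A by (intro mult_left_mono) (auto simp: square_bounded_def)
  also have "\<dots> = ennreal (B\<^sup>2 * S)"
    using S by (simp add: ennreal_mult)
  finally show "(\<Sum>m\<in>A. \<integral>\<^sup>+ \<xi>. ennreal ((cmod (r m \<xi>))\<^sup>2) \<partial>lborel) \<le> ennreal (B\<^sup>2 * S)" .
qed

section \<open>The symbol and its distance from zero\<close>

lemma Re_P: "Re (P l z m \<xi>) = freq l * of_int m * (freq l * of_int m + 2 * Re z)"
  and Im_P: "Im (P l z m \<xi>) = 2 * freq l * of_int m * Im z + \<xi>"
  by (simp_all add: P_def power2_eq_square algebra_simps)

lemma P_diff: "P l z m \<xi> - P l z' m \<xi> = 2 * of_real (freq l) * of_int m * (z - z')"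
  by (simp add: P_def algebra_simps)

lemma P_borel [measurable]: "P l z m \<in> borel_measurable borel"
  unfolding P_def[abs_def] by (intro borel_measurable_continuous_onI continuous_intros)

text \<open>
  The affine function \<open>freq l * m + 2 * Re z0\<close> vanishes at no \<open>m \<noteq> 0\<close> and dominates half
  of its linear part outside a finite range, so finitely many modes determine the
  constant.
\<close>
lemma C_freq_gap:
  assumes l: "l > 0" and z0: "z0 \<in> C_freq l"
  obtains c where "c > 0" "\<And>m. m \<noteq> 0 \<Longrightarrow> c * \<bar>of_int m\<bar> \<le> \<bar>freq l * of_int m + 2 * Re z0\<bar>"
proof -
  define w where "w = freq l"
  have w: "w > 0" unfolding w_def by (rule freq_times(2)[OF l])
  define N where "N = \<lceil>4 * \<bar>Re z0\<bar> / w\<rceil>"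
  define F where "F = {-N..N} - {0}"
  define c where "c = Min (insert (w / 2) ((\<lambda>m. \<bar>w * of_int m + 2 * Re z0\<bar> / \<bar>of_int m\<bar>) ` F))"
  have F: "finite F" by (simp add: F_def)
  have nz: "w * of_int m + 2 * Re z0 \<noteq> 0" if "m \<noteq> 0" for m
  proof
    assume "w * of_int m + 2 * Re z0 = 0"
    then have "2 * Re z0 = freq l * of_int (- m)" by (simp add: w_def)
    moreover have "- m \<in> UNIV - {0}" using that by simp
    ultimately have "2 * Re z0 \<in> (\<lambda>m::int. freq l * of_int m) ` (UNIV - {0})" by (rule image_eqI)
    then show False using z0 by (simp add: C_freq_def)
  qed
  show ?thesis
  proof
    show "c > 0"
      unfolding c_def using w F nz by (subst Min_gr_iff) (auto simp: F_def)
    fix m :: int assume m: "m \<noteq> 0"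
    have "c * \<bar>of_int m\<bar> \<le> \<bar>w * of_int m + 2 * Re z0\<bar>"
    proof (cases "m \<in> F")
      case True
      then have "c \<le> \<bar>w * of_int m + 2 * Re z0\<bar> / \<bar>of_int m\<bar>"
        unfolding c_def using F by (intro Min_le) auto
      then show ?thesis using m by (simp add: field_simps)
    next
      case False
      then have "\<bar>m\<bar> > N" using m by (auto simp: F_def)
      then have "4 * \<bar>Re z0\<bar> / w < of_int \<bar>m\<bar>"
        unfolding N_def by linarith
      then have *: "4 * \<bar>Re z0\<bar> < w * \<bar>of_int m\<bar>"
        using w by (simp add: field_simps)
      have "c \<le> w / 2"
        unfolding c_def using F by (intro Min_le) auto
      then have "c * \<bar>of_int m\<bar> \<le> w / 2 * \<bar>of_int m\<bar>"
        by (rule mult_right_mono) simp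
      also have "\<dots> \<le> \<bar>w * of_int m\<bar> - \<bar>2 * Re z0\<bar>"
        using * w by (simp add: abs_mult)
      also have "\<dots> \<le> \<bar>w * of_int m + 2 * Re z0\<bar>"
        by linarith
      finally show ?thesis .
    qed
    then show "c * \<bar>of_int m\<bar> \<le> \<bar>freq l * of_int m + 2 * Re z0\<bar>" by (simp add: w_def)
  qed
qed

text \<open>
  The real part of \<open>P\<close> does not depend on \<open>\<xi>\<close>, and moving \<open>z\<close> by at most \<open>c / 4\<close> costs at
  most half of the gap at \<open>z0\<close>.
\<close>
lemma uniform_symbol_gap:
  assumes l: "l > 0" and z0: "z0 \<in> C_freq l"
  obtains d r where "d > 0" "r > 0"
    "\<And>z m \<xi>. cmod (z - z0) \<le> r \<Longrightarrow> m \<noteq> 0 \<Longrightarrow> d * (of_int m)\<^sup>2 \<le> \<bar>Re (P l z m \<xi>)\<bar>"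
proof -
  obtain c where c: "c > 0" "\<And>m. m \<noteq> 0 \<Longrightarrow> c * \<bar>of_int m\<bar> \<le> \<bar>freq l * of_int m + 2 * Re z0\<bar>"
    using C_freq_gap[OF l z0] by metis
  have w: "freq l > 0" by (rule freq_times(2)[OF l])
  show ?thesis
  proof
    show "freq l * (c / 2) > 0" "c / 4 > 0" using w c by auto
    fix z m \<xi> assume z: "cmod (z - z0) \<le> c / 4" and m: "m \<noteq> (0::int)"
    have "\<bar>Re z - Re z0\<bar> \<le> c / 4" using abs_Re_le_cmod[of "z - z0"] z by simp
    moreover have "c / 2 \<le> c / 2 * \<bar>of_int m\<bar>" using m c(1) by simp
    ultimately have "c / 2 * \<bar>of_int m\<bar> \<le> \<bar>freq l * of_int m + 2 * Re z\<bar>"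
      using c(2)[OF m] by linarith
    then have "(freq l * \<bar>of_int m\<bar>) * (c / 2 * \<bar>of_int m\<bar>)
        \<le> (freq l * \<bar>of_int m\<bar>) * \<bar>freq l * of_int m + 2 * Re z\<bar>"
      using w by (intro mult_left_mono) auto
    also have "\<dots> = \<bar>Re (P l z m \<xi>)\<bar>"
      using w by (simp add: Re_P abs_mult)
    finally show "freq l * (c / 2) * (of_int m)\<^sup>2 \<le> \<bar>Re (P l z m \<xi>)\<bar>"
      by (simp add: power2_eq_square mult_ac)
  qed
qed

lemma nn_integral_inverse_square_shift:
  fixes a b :: real
  assumes a: "a \<noteq> 0"
  shows "(\<integral>\<^sup>+ \<xi>. ennreal (1 / (a\<^sup>2 + (b + \<xi>)\<^sup>2)) \<partial>lborel) = ennreal (pi / \<bar>a\<bar>)"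
proof -
  have i: "integrable lborel (\<lambda>x::real. inverse (1 + x\<^sup>2))"
    using integrable_inverse_1_plus_square by (simp add: set_integrable_def)
  have "(LINT x|lborel. inverse (1 + x\<^sup>2)) = pi"
    using LBINT_inverse_1_plus_square by (simp add: interval_lebesgue_integral_def
        set_lebesgue_integral_def)
  then have base: "(\<integral>\<^sup>+ x. ennreal (inverse (1 + x\<^sup>2)) \<partial>lborel) = ennreal pi"
    using i by (subst nn_integral_eq_integral) auto
  have "(\<integral>\<^sup>+ \<xi>. ennreal (1 / (a\<^sup>2 + (b + \<xi>)\<^sup>2)) \<partial>lborel)
    = ennreal \<bar>a\<bar> * (\<integral>\<^sup>+ x. ennreal (1 / (a\<^sup>2 + (b + (- b + a * x))\<^sup>2)) \<partial>lborel)"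
    by (rule nn_integral_real_affine[OF _ a]) measurable
  also have "(\<lambda>x. ennreal (1 / (a\<^sup>2 + (b + (- b + a * x))\<^sup>2)))
      = (\<lambda>x. ennreal (1 / a\<^sup>2) * ennreal (inverse (1 + x\<^sup>2)))"
  proof
    fix x
    have "1 / (a\<^sup>2 + (b + (- b + a * x))\<^sup>2) = 1 / a\<^sup>2 * inverse (1 + x\<^sup>2)"
    proof -
      have "a\<^sup>2 + (b + (- b + a * x))\<^sup>2 = a\<^sup>2 * (1 + x\<^sup>2)" by
          (simp add: power_mult_distrib algebra_simps)
      then show ?thesis by (simp add: divide_inverse)
    qed
    then show "ennreal (1 / (a\<^sup>2 + (b + (- b + a * x))\<^sup>2))
        = ennreal (1 / a\<^sup>2) * ennreal (inverse (1 + x\<^sup>2))"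
      by (simp only:) (rule ennreal_mult, auto)
  qed
  also have "ennreal \<bar>a\<bar> * (\<integral>\<^sup>+ x. ennreal (1 / a\<^sup>2) * ennreal (inverse (1 + x\<^sup>2)) \<partial>lborel)
      = ennreal \<bar>a\<bar> * (ennreal (1 / a\<^sup>2) * ennreal pi)"
    by (subst nn_integral_cmult) (auto simp: base)
  also have "\<dots> = ennreal (\<bar>a\<bar> * (1 / a\<^sup>2 * pi))"
    by (subst ennreal_mult[symmetric], simp, simp, subst ennreal_mult[symmetric]) auto
  also have "\<bar>a\<bar> * (1 / a\<^sup>2 * pi) = pi / \<bar>a\<bar>"
    using a by (simp add: power2_eq_square field_simps abs_if)
  finally show ?thesis .
qed

lemma summable_inverse_squares_int: "(\<lambda>m::int. 1 / (of_int m)\<^sup>2 :: real) summable_on (UNIV - {0})"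
proof (rule nonneg_bdd_above_summable_on)
  let ?s = "\<Sum>n. 1 / (real (Suc n))\<^sup>2"
  have sm: "summable (\<lambda>n. 1 / (real (Suc n))\<^sup>2)"
    using inverse_squares_sums sums_summable by fastforce
  show "bdd_above (sum (\<lambda>m::int. 1 / (of_int m)\<^sup>2 :: real) ` {F. F \<subseteq> UNIV - {0} \<and> finite F})"
  proof (rule bdd_aboveI2)
    fix F :: "int set" assume F: "F \<in> {F. F \<subseteq> UNIV - {0} \<and> finite F}"
    define N where "N = nat (Max (insert 0 (abs ` F)))"
    have "F \<subseteq> (\<lambda>n. int (Suc n)) ` {..<N} \<union> (\<lambda>n. - int (Suc n)) ` {..<N}"
    proof
      fix m assume m: "m \<in> F"
      then have "\<bar>m\<bar> \<le> Max (insert 0 (abs ` F))" using F by (intro Max_ge) auto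
      then have "nat \<bar>m\<bar> \<le> N" by (simp add: N_def nat_mono)
      moreover have "m \<noteq> 0" using F m by auto
      ultimately have N: "nat \<bar>m\<bar> - 1 \<in> {..<N}"
        and "m = int (Suc (nat \<bar>m\<bar> - 1)) \<or> m = - int (Suc (nat \<bar>m\<bar> - 1))" by (simp_all, linarith+)
      then show "m \<in> (\<lambda>n. int (Suc n)) ` {..<N} \<union> (\<lambda>n. - int (Suc n)) ` {..<N}"
        by (elim disjE) (rule UnI1, erule image_eqI[OF _ N], rule UnI2, erule image_eqI[OF _ N])
    qed
    then have "(\<Sum>m\<in>F. 1 / (of_int m)\<^sup>2 :: real)
        \<le> (\<Sum>m\<in>(\<lambda>n. int (Suc n)) ` {..<N} \<union> (\<lambda>n. - int (Suc n)) ` {..<N}. 1 / (of_int m)\<^sup>2)"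
      by (intro sum_mono2) auto
    also have "\<dots> \<le> (\<Sum>m\<in>(\<lambda>n. int (Suc n)) ` {..<N}. 1 / (of_int m)\<^sup>2) + (\<Sum>m\<in>(\<lambda>n. - int
        (Suc n)) ` {..<N}. 1 / (of_int m)\<^sup>2)"
      using sum.union_inter[of "(\<lambda>n. int (Suc n)) ` {..<N}" "(\<lambda>n. - int (Suc n)) ` {..<N}"
          "\<lambda>m::int. 1 / (of_int m)\<^sup>2 :: real"]
        sum_nonneg[of "(\<lambda>n. int (Suc n)) ` {..<N} \<inter> (\<lambda>n. - int (Suc n)) ` {..<N}" "\<lambda>m::int. 1 /
            (of_int m)\<^sup>2 :: real"]
      by (simp only: finite_imageI finite_lessThan) simp
    also have "\<dots> = (\<Sum>n<N. 1 / (real (Suc n))\<^sup>2) + (\<Sum>n<N. 1 / (real (Suc n))\<^sup>2)"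
    proof -
      have "((- 1) - x)\<^sup>2 = (1 + x)\<^sup>2" for x :: real by (simp add: power2_eq_square algebra_simps)
      then show ?thesis by (subst (1 2) sum.reindex) (auto simp: inj_on_def)
    qed
    also have "\<dots> \<le> ?s + ?s"
      by (intro add_mono sum_le_suminf sm) auto
    finally show "(\<Sum>m\<in>F. 1 / (of_int m)\<^sup>2 :: real) \<le> ?s + ?s" .
  qed
qed simp

lemma inverse_symbol_norm_sq:
  "(cmod (1 / P l z m \<xi>))\<^sup>2 = 1 / ((Re (P l z m 0))\<^sup>2 + (Im (P l z m 0) + \<xi>)\<^sup>2)"
  by (simp add: norm_divide power_divide cmod_power2 Re_P Im_P)

lemma translated_symbol_norm_le:
  "ennreal ((cmod (1 / P l z m \<xi> * (plane_wave l m \<xi> h - 1)))\<^sup>2)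
      \<le> ennreal 4 * ennreal ((cmod (1 / P l z m \<xi>))\<^sup>2)"
proof -
  have "cmod (plane_wave l m \<xi> h - 1) \<le> 2"
    using norm_triangle_ineq4[of "plane_wave l m \<xi> h" 1] by simp
  then have "(cmod (plane_wave l m \<xi> h - 1))\<^sup>2 \<le> 2\<^sup>2"
    by (intro power_mono) auto
  then have "(cmod (1 / P l z m \<xi> * (plane_wave l m \<xi> h - 1)))\<^sup>2 \<le> 4 * (cmod (1 / P l z m \<xi>))\<^sup>2"
    unfolding norm_mult power_mult_distrib by (subst mult.commute, intro mult_right_mono) auto
  then show ?thesis
    by (subst ennreal_mult[symmetric]) (auto intro: ennreal_leI)
qed

context
  fixes l d :: real and z :: complex
  assumes l: "l > 0" and d: "d > 0"
    and gap: "\<And>m \<xi>. m \<noteq> 0 \<Longrightarrow> d * (of_int m)\<^sup>2 \<le> \<bar>Re (P l z m \<xi>)\<bar>"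
begin

text \<open>
  On a single mode \<open>1 / |P|\<^sup>2\<close> is a multiple of a Cauchy density in \<open>\<xi>\<close>, of total mass \<open>pi
  / |Re P|\<close>.
\<close>
lemma inverse_symbol_energy:
  assumes "m \<noteq> 0"
  shows "(\<integral>\<^sup>+ \<xi>. ennreal ((cmod (1 / P l z m \<xi>))\<^sup>2) \<partial>lborel) \<le> ennreal (pi / d * (1 / (of_int m)\<^sup>2))"
proof -
  have p: "0 < d * (of_int m)\<^sup>2" using d assms by simp
  then have "Re (P l z m 0) \<noteq> 0" using gap[OF assms, of 0] by auto
  then have "(\<integral>\<^sup>+ \<xi>. ennreal ((cmod (1 / P l z m \<xi>))\<^sup>2) \<partial>lborel) = ennreal (pi / \<bar>Re (P l z m 0)\<bar>)"
    unfolding inverse_symbol_norm_sq by (rule nn_integral_inverse_square_shift)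
  also have "\<dots> \<le> ennreal (pi / (d * (of_int m)\<^sup>2))"
    using gap[OF assms, of 0] p by (intro ennreal_leI divide_left_mono) auto
  finally show ?thesis by simp
qed

lemma inverse_symbol_square_bounded:
  "square_bounded (pi / d * (\<Sum>\<^sub>\<infinity>m\<in>UNIV - {0::int}. 1 / (of_int m)\<^sup>2)) (\<lambda>m \<xi>. 1 / P l z m \<xi>)"
  unfolding square_bounded_def
proof (intro conjI allI impI)
  let ?s = "(\<Sum>\<^sub>\<infinity>m\<in>UNIV - {0::int}. 1 / (of_int m)\<^sup>2) :: real"
  have s0: "0 \<le> ?s" by (rule infsum_nonneg) simp
  then show "0 \<le> pi / d * ?s" using d by simp
  show "(\<lambda>\<xi>. 1 / P l z m \<xi>) \<in> borel_measurable borel" for m by measurable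
  fix A :: "int set" assume A: "finite A \<and> 0 \<notin> A"
  have "(\<Sum>m\<in>A. \<integral>\<^sup>+ \<xi>. ennreal ((cmod (1 / P l z m \<xi>))\<^sup>2) \<partial>lborel)
      \<le> (\<Sum>m\<in>A. ennreal (pi / d * (1 / (of_int m)\<^sup>2)))"
    using A by (intro sum_mono inverse_symbol_energy) auto
  also have "\<dots> = ennreal (pi / d * (\<Sum>m\<in>A. 1 / (of_int m)\<^sup>2))"
    unfolding sum_distrib_left by (rule sum_ennreal) (use d in auto)
  also have "\<dots> \<le> ennreal (pi / d * ?s)"
    using d A by (intro ennreal_leI mult_left_mono finite_sum_le_infsum
        summable_inverse_squares_int) auto
  finally show "(\<Sum>m\<in>A. \<integral>\<^sup>+ \<xi>. ennreal ((cmod (1 / P l z m \<xi>))\<^sup>2) \<partial>lborel) \<le> ennreal (pi / d * ?s)" .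
qed

text \<open>
  Dominated convergence on one mode: the plane wave at \<open>h\<close> tends to \<open>1\<close> as \<open>h\<close> tends to
  zero, and \<open>4 / |P|\<^sup>2\<close> is an integrable majorant.
\<close>
lemma translated_mode_small:
  assumes m: "m \<noteq> 0" and \<eta>: "\<eta> > 0"
  obtains \<delta> where "\<delta> > 0"
    "\<And>h. norm h < \<delta> \<Longrightarrow> (\<integral>\<^sup>+ \<xi>. ennreal ((cmod (1 / P l z m \<xi> * (plane_wave l m \<xi> h - 1)))\<^sup>2) \<partial>lborel)
        \<le> ennreal \<eta>"
proof -
  define J where "J h = (\<integral>\<^sup>+ \<xi>. ennreal ((cmod (1 / P l z m \<xi> * (plane_wave l m \<xi> h
      - 1)))\<^sup>2) \<partial>lborel)" for h
  have "\<exists>\<delta>>0. \<forall>h. norm h < \<delta> \<longrightarrow> J h \<le> ennreal \<eta>"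
  proof (rule ccontr)
    assume neg: "\<not> ?thesis"
    have "\<exists>h. norm h < 1 / real (Suc n) \<and> \<not> J h \<le> ennreal \<eta>" for n
    proof -
      have "1 / real (Suc n) > 0" by simp
      then show ?thesis using neg by blast
    qed
    then obtain h where h: "\<And>n. norm (h n) < 1 / real (Suc n)" and J: "\<And>n. \<not> J (h n) \<le> ennreal \<eta>"
      by metis
    have h0: "h \<longlonglongrightarrow> 0"
      by (rule Lim_null_comparison[OF _ LIMSEQ_Suc[OF lim_1_over_n]]) (use h in \<open>simp add: less_imp_le\<close>)
    have "(\<lambda>n. J (h n)) \<longlonglongrightarrow> (\<integral>\<^sup>+ \<xi>. 0 \<partial>(lborel :: real measure))"
      unfolding J_def
    proof (rule nn_integral_dominated_convergence)
      show "(\<integral>\<^sup>+ \<xi>. ennreal 4 * ennreal ((cmod (1 / P l z m \<xi>))\<^sup>2) \<partial>lborel) < \<infinity>"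
      proof (subst nn_integral_cmult)
        have "ennreal 4 * (\<integral>\<^sup>+ \<xi>. ennreal ((cmod (1 / P l z m \<xi>))\<^sup>2) \<partial>lborel)
            \<le> ennreal 4 * ennreal (pi / d * (1 / (of_int m)\<^sup>2))"
          by (rule mult_left_mono[OF inverse_symbol_energy[OF m]]) simp
        also have "\<dots> < \<infinity>" by (simp add: ennreal_mult_less_top)
        finally show "ennreal 4 * (\<integral>\<^sup>+ \<xi>. ennreal ((cmod (1 / P l z m \<xi>))\<^sup>2) \<partial>lborel) < \<infinity>" .
      qed measurable
      show "AE \<xi> in lborel. ennreal ((cmod (1 / P l z m \<xi> * (plane_wave l m \<xi> (h n) - 1)))\<^sup>2)
          \<le> ennreal 4 * ennreal ((cmod (1 / P l z m \<xi>))\<^sup>2)" for n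
        by (intro AE_I2 translated_symbol_norm_le)
      show "AE \<xi> in lborel. (\<lambda>n. ennreal ((cmod (1 / P l z m \<xi> * (plane_wave l m \<xi> (h n) - 1)))\<^sup>2)) \<longlonglongrightarrow> 0"
      proof (rule AE_I2)
        fix \<xi>
        have "isCont (plane_wave l m \<xi>) 0"
          by (rule continuous_on_interior[OF continuous_plane_wave[of UNIV]]) simp
        from isCont_tendsto_compose[OF this h0] have "(\<lambda>n. plane_wave l m \<xi>
            (h n)) \<longlonglongrightarrow> plane_wave l m \<xi> 0" .
        then have "(\<lambda>n. (cmod (1 / P l z m \<xi> * (plane_wave l m \<xi> (h n) - 1)))\<^sup>2) \<longlonglongrightarrow> (cmod
            (1 / P l z m \<xi> * (plane_wave l m \<xi> 0 - 1)))\<^sup>2"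
          by (intro tendsto_intros)
        then have "(\<lambda>n. (cmod (1 / P l z m \<xi> * (plane_wave l m \<xi> (h n) - 1)))\<^sup>2) \<longlonglongrightarrow> 0"
          by (simp add: plane_wave_def)
        from tendsto_ennrealI[OF this] show "(\<lambda>n. ennreal ((cmod (1 / P l z m \<xi> * (plane_wave l m \<xi>
            (h n) - 1)))\<^sup>2)) \<longlonglongrightarrow> 0"
          by simp
      qed
    qed measurable
    then have "\<forall>\<^sub>F n in sequentially. J (h n) < ennreal \<eta>"
      using \<eta> by (intro order_tendstoD) auto
    then obtain n where "J (h n) < ennreal \<eta>" by (auto simp: eventually_sequentially)
    then show False using J[of n] by simp
  qed
  then show ?thesis using that unfolding J_def by blast
qed

text \<open>
  The modes outside a finite set \<open>F\<close> contribute at most \<open>\<epsilon> / 2\<close> for every \<open>h\<close>, since the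
  majorants \<open>4 pi / (d m\<^sup>2)\<close> are summable. The finitely many modes in \<open>F\<close> are treated one
  by one.
\<close>
lemma translated_symbol_small:
  assumes \<epsilon>: "\<epsilon> > 0"
  shows "\<exists>\<delta>>0. \<forall>h. norm h < \<delta> \<longrightarrow>
    square_bounded \<epsilon> (\<lambda>m \<xi>. 1 / P l z m \<xi> * (plane_wave l m \<xi> h - 1))"
proof -
  let ?J = "\<lambda>h m. \<integral>\<^sup>+ \<xi>. ennreal ((cmod (1 / P l z m \<xi> * (plane_wave l m \<xi> h - 1)))\<^sup>2) \<partial>lborel"
  let ?t = "\<lambda>m::int. 1 / (of_int m)\<^sup>2 :: real"
  define \<gamma> where "\<gamma> = \<epsilon> / 2 / (4 * pi / d)"
  have \<gamma>: "\<gamma> > 0" using \<epsilon> d by (simp add: \<gamma>_def)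
  obtain F where F: "finite F" "F \<subseteq> UNIV - {0}" "dist (sum ?t F) (infsum ?t (UNIV - {0})) \<le> \<gamma>"
    using infsum_finite_approximation[OF summable_inverse_squares_int \<gamma>] by blast
  have tail: "sum ?t B \<le> \<gamma>" if "finite B" "B \<inter> F = {}" "0 \<notin> B" for B
  proof -
    have "sum ?t (B \<union> F) \<le> infsum ?t (UNIV - {0})"
      using that F by (intro finite_sum_le_infsum summable_inverse_squares_int) auto
    then show ?thesis
      using F(3) that F(1) by (simp add: sum.union_disjoint dist_real_def)
  qed
  define \<eta> where "\<eta> = \<epsilon> / 2 / (real (card F) + 1)"
  have \<eta>: "\<eta> > 0" using \<epsilon> by (simp add: \<eta>_def add_pos_nonneg)
  have n0: "real (card F) + 1 \<noteq> 0" by linarith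
  have "\<forall>m\<in>F. \<exists>\<delta>>0. \<forall>h. norm h < \<delta> \<longrightarrow> ?J h m \<le> ennreal \<eta>"
  proof
    fix m assume "m \<in> F"
    then have "m \<noteq> 0" using F by auto
    from translated_mode_small[OF this \<eta>] show "\<exists>\<delta>>0. \<forall>h. norm h < \<delta> \<longrightarrow> ?J h m \<le> ennreal \<eta>" by metis
  qed
  from bchoice[OF this] obtain D
    where D': "\<forall>m\<in>F. D m > 0 \<and> (\<forall>h. norm h < D m \<longrightarrow> ?J h m \<le> ennreal \<eta>)" ..
  have D: "D m > 0" "norm h < D m \<Longrightarrow> ?J h m \<le> ennreal \<eta>" if "m \<in> F" for m h
    using D' that by blast+
  define \<delta> where "\<delta> = Min (insert 1 (D ` F))"
  show ?thesis
  proof (intro exI[of _ \<delta>] conjI allI impI)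
    show "\<delta> > 0" unfolding \<delta>_def using F(1) D(1) by (subst Min_gr_iff) auto
    fix h :: "real \<times> real" assume h: "norm h < \<delta>"
    show "square_bounded \<epsilon> (\<lambda>m \<xi>. 1 / P l z m \<xi> * (plane_wave l m \<xi> h - 1))"
      unfolding square_bounded_def
    proof (intro conjI allI impI)
      show "0 \<le> \<epsilon>" using \<epsilon> by simp
      show "(\<lambda>\<xi>. 1 / P l z m \<xi> * (plane_wave l m \<xi> h - 1)) \<in> borel_measurable borel" for m by measurable
      fix A :: "int set" assume A: "finite A \<and> 0 \<notin> A"
      have "(\<Sum>m\<in>A. ?J h m) = (\<Sum>m\<in>A \<inter> F. ?J h m) + (\<Sum>m\<in>A - F. ?J h m)"
        using A by (subst sum.union_disjoint[symmetric]) (auto intro!: sum.cong)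
      also have "\<dots> \<le> ennreal (\<epsilon> / 2) + ennreal (\<epsilon> / 2)"
      proof (rule add_mono)
        have "(\<Sum>m\<in>A \<inter> F. ?J h m) \<le> (\<Sum>m\<in>A \<inter> F. ennreal \<eta>)"
        proof (intro sum_mono D(2))
          fix m assume m: "m \<in> A \<inter> F"
          then show "m \<in> F" by simp
          have "\<delta> \<le> D m" unfolding \<delta>_def using F(1) m by (intro Min_le) auto
          with h show "norm h < D m" by simp
        qed
        also have "\<dots> = ennreal (real (card (A \<inter> F)) * \<eta>)"
          using \<eta> by (subst sum_ennreal) auto
        also have "\<dots> \<le> ennreal (\<epsilon> / 2)"
        proof (rule ennreal_leI)
          have "real (card (A \<inter> F)) * \<eta> \<le> (real (card F) + 1) * \<eta>"
            using \<eta> F(1) card_mono[of F "A \<inter> F"] by (intro mult_right_mono) auto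
          also have "\<dots> = \<epsilon> / 2"
            by (simp only: \<eta>_def times_divide_eq_right[of "real (card F) + 1"
                "\<epsilon> / 2"] nonzero_mult_div_cancel_left[OF n0])
          finally show "real (card (A \<inter> F)) * \<eta> \<le> \<epsilon> / 2" .
        qed
        finally show "(\<Sum>m\<in>A \<inter> F. ?J h m) \<le> ennreal (\<epsilon> / 2)" .
        have "(\<Sum>m\<in>A - F. ?J h m) \<le> (\<Sum>m\<in>A - F. ennreal (4 * pi / d * ?t m))"
        proof (intro sum_mono)
          fix m assume "m \<in> A - F"
          then have m: "m \<noteq> 0" using A by auto
          have "?J h m \<le> (\<integral>\<^sup>+ \<xi>. ennreal 4 * ennreal ((cmod (1 / P l z m \<xi>))\<^sup>2) \<partial>lborel)"
            by (intro nn_integral_mono translated_symbol_norm_le)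
          also have "\<dots> = ennreal 4 * (\<integral>\<^sup>+ \<xi>. ennreal ((cmod (1 / P l z m \<xi>))\<^sup>2) \<partial>lborel)"
            by (rule nn_integral_cmult) measurable
          also have "\<dots> \<le> ennreal 4 * ennreal (pi / d * ?t m)"
            by (rule mult_left_mono[OF inverse_symbol_energy[OF m]]) simp
          also have "\<dots> = ennreal (4 * pi / d * ?t m)"
            using d by (subst ennreal_mult[symmetric]) auto
          finally show "?J h m \<le> ennreal (4 * pi / d * ?t m)" .
        qed
        also have "\<dots> = ennreal (4 * pi / d * sum ?t (A - F))"
          unfolding sum_distrib_left by (rule sum_ennreal) (use d in auto)
        also have "\<dots> \<le> ennreal (4 * pi / d * \<gamma>)"
          using tail[of "A - F"] A d by (intro ennreal_leI mult_left_mono) auto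
        also have "4 * pi / d * \<gamma> = \<epsilon> / 2" using d by (simp add: \<gamma>_def)
        finally show "(\<Sum>m\<in>A - F. ?J h m) \<le> ennreal (\<epsilon> / 2)" .
      qed
      also have "ennreal (\<epsilon> / 2) + ennreal (\<epsilon> / 2) = ennreal \<epsilon>"
        using \<epsilon> by (subst ennreal_plus[symmetric]) auto
      finally show "(\<Sum>m\<in>A. ?J h m) \<le> ennreal \<epsilon>" .
    qed
  qed
qed

end

section \<open>Compactness of the integral operator\<close>

text \<open>
  A diagonal subsequence converges on a countable dense set, and equicontinuity carries
  convergence to every point.
\<close>
lemma equicontinuous_convergent_subsequence:
  fixes G :: "nat \<Rightarrow> 'a::{real_normed_vector, second_countable_topology} \<Rightarrow> complex"
  assumes bdd: "\<And>n p. cmod (G n p) \<le> M"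
    and equi: "\<And>\<epsilon>. \<epsilon> > 0 \<Longrightarrow> \<exists>\<delta>>0. \<forall>n p h. norm h < \<delta> \<longrightarrow> cmod (G n (p + h) - G n p) \<le> \<epsilon>"
  obtains r g where "strict_mono r" "\<And>p. (\<lambda>n. G (r n) p) \<longlonglongrightarrow> g p"
proof -
  obtain D :: "'a set" where D: "countable D" "\<And>X. open X \<Longrightarrow> X \<noteq> {} \<Longrightarrow> \<exists>d\<in>D. d \<in> X"
    using countable_dense_setE by blast
  obtain r :: "nat \<Rightarrow> nat" where r: "strict_mono r" "\<And>d. d \<in> D \<Longrightarrow> \<exists>c. (\<lambda>n. G (r n) d) \<longlonglongrightarrow> c"
    using function_convergent_subsequence[OF D(1), of G M] bdd by blast
  have "Cauchy (\<lambda>n. G (r n) p)" for p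
  proof (rule CauchyI)
    fix e :: real assume e: "e > 0"
    then obtain \<delta> where \<delta>: "\<delta> > 0" "\<And>n p h. norm h < \<delta> \<Longrightarrow> cmod (G n (p + h) - G n p) \<le> e / 4"
      using equi[of "e / 4"] by auto
    obtain d where d: "d \<in> D" "d \<in> ball p \<delta>"
      using D(2)[of "ball p \<delta>"] \<delta>(1) by auto
    have near: "cmod (G n d - G n p) \<le> e / 4" for n
      using \<delta>(2)[of "d - p" n p] d(2) by (simp add: dist_norm norm_minus_commute)
    have "Cauchy (\<lambda>n. G (r n) d)"
      using r(2)[OF d(1)] by (auto intro: LIMSEQ_imp_Cauchy)
    then obtain N where N: "\<And>m n. m \<ge> N \<Longrightarrow> n \<ge> N \<Longrightarrow> cmod (G (r m) d - G (r n) d) < e / 4"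
      using CauchyD[of _ "e / 4"] e by (metis divide_pos_pos zero_less_numeral)
    have "cmod (G (r m) p - G (r n) p) < e" if "m \<ge> N" "n \<ge> N" for m n
    proof -
      have "G (r m) p - G (r n) p = (G (r m) d - G (r n) d) - (G (r m) d - G (r m) p) + (G (r n) d
          - G (r n) p)"
        by simp
      also have "cmod \<dots> \<le> cmod (G (r m) d - G (r n) d) + cmod (G (r m) d - G (r m) p) + cmod (G
          (r n) d - G (r n) p)"
        by (intro norm_triangle_le add_mono norm_triangle_ineq4 order_refl)
      finally show ?thesis using N[OF that] near[of "r m"] near[of "r n"] e by linarith
    qed
    then show "\<exists>N. \<forall>m\<ge>N. \<forall>n\<ge>N. cmod (G (r m) p - G (r n) p) < e" by blast
  qed
  then have "\<exists>c. (\<lambda>n. G (r n) p) \<longlonglongrightarrow> c" for p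
    using Cauchy_convergent convergent_def by blast
  then obtain g where "\<And>p. (\<lambda>n. G (r n) p) \<longlonglongrightarrow> g p" by metis
  with r(1) show ?thesis using that by blast
qed

text \<open>
  The operator \<open>T\<^sub>z\<close>. It is a multiplier with symbol \<open>1 / P\<close>, which inverts \<open>-\<partial>\<^sub>y + \<partial>\<^sub>x\<^sup>2
  + 2iz\<partial>\<^sub>x\<close> up to sign on the nonzero modes, applied after multiplication by the
  potential.
\<close>
definition resolvent :: "real \<Rightarrow> (real \<times> real \<Rightarrow> complex) \<Rightarrow> complex \<Rightarrow>
    (real \<times> real \<Rightarrow> complex) \<Rightarrow> real \<times> real \<Rightarrow> complex" where
  "resolvent l u z \<nu> = multiplier l (\<lambda>m \<xi>. 1 / P l z m \<xi>) (\<lambda>q. u q * \<nu> q)"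

lemma bounded_solution_iff:
  "bounded_solution l u z \<nu> \<longleftrightarrow> x_periodic l \<nu> \<and> \<nu> \<in> borel_measurable (lebesgue_on (Strip l)) \<and>
    bounded (\<nu> ` Strip l) \<and> (\<forall>p\<in>Strip l. \<nu> p = 1 + resolvent l u z \<nu> p)"
  unfolding bounded_solution_def resolvent_def multiplier_def plane_wave_def
  by (simp add: case_prod_beta')

lemma x_periodic_multiplier:
  assumes l: "l > 0"
  shows "x_periodic l (multiplier l q f)"
proof -
  have "plane_wave l m \<xi> (x + 2 * l, y) = plane_wave l m \<xi> (x, y)" for m \<xi> x y
  proof -
    have "freq l * of_int m * (x + 2 * l) = freq l * of_int m * x + 2 * of_int m * (freq l * l)"
      by (simp add: algebra_simps)
    also have "\<dots> = freq l * of_int m * x + real_of_int (2 * m) * pi"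
      by (simp add: freq_times[OF l])
    finally show ?thesis
      unfolding plane_wave_def fst_conv snd_conv exp_eq
      by (intro exI[of _ m]) (simp only: of_real_add, simp add: algebra_simps)
  qed
  then show ?thesis by (simp add: x_periodic_def multiplier_def)
qed

locale strip_potential =
  fixes l :: real and u :: "real \<times> real \<Rightarrow> complex"
  assumes l: "l > 0" and u: "in_L1_L2 l u"
begin

abbreviation strip_measurable :: "(real \<times> real \<Rightarrow> complex) \<Rightarrow> bool" where
  "strip_measurable \<nu> \<equiv> \<nu> \<in> borel_measurable (lebesgue_on (Strip l))"

lemma potential_mult:
  assumes \<nu>: "strip_measurable \<nu>" and B: "\<And>p. p \<in> Strip l \<Longrightarrow> cmod (\<nu> p) \<le> B"
  shows "in_L1_L2 l (\<lambda>q. u q * \<nu> q)" and "energy l (\<lambda>q. u q * \<nu> q) \<le> B\<^sup>2 * energy l u"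
proof -
  let ?M = "lebesgue_on (Strip l)"
  have i: "integrable ?M u" "integrable ?M (\<lambda>q. (cmod (u q))\<^sup>2)" using u by (auto simp: in_L1_L2_def)
  have m: "(\<lambda>q. u q * \<nu> q) \<in> borel_measurable ?M"
    by (rule borel_measurable_times[OF borel_measurable_integrable[OF i(1)] \<nu>])
  have sq: "(cmod (u q * \<nu> q))\<^sup>2 \<le> B\<^sup>2 * (cmod (u q))\<^sup>2" if "q \<in> Strip l" for q
    unfolding norm_mult power_mult_distrib using B[OF that]
    by (subst mult.commute) (intro mult_right_mono power_mono, auto)
  have 1: "integrable ?M (\<lambda>q. u q * \<nu> q)"
  proof (rule Bochner_Integration.integrable_bound[OF _ m])
    show "integrable ?M (\<lambda>q. of_real B * u q)" using i(1) by simp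
    show "AE q in ?M. norm (u q * \<nu> q) \<le> norm (of_real B * u q)"
    proof (rule AE_I2)
      fix q assume "q \<in> space ?M"
      then have "cmod (\<nu> q) \<le> \<bar>B\<bar>" using B[of q] by auto
      then show "norm (u q * \<nu> q) \<le> norm (of_real B * u q)"
        by (simp add: norm_mult mult.commute mult_right_mono)
    qed
  qed
  have 2: "integrable ?M (\<lambda>q. (cmod (u q * \<nu> q))\<^sup>2)"
  proof (rule Bochner_Integration.integrable_bound)
    show "integrable ?M (\<lambda>q. B\<^sup>2 * (cmod (u q))\<^sup>2)" using i(2) by simp
    show "(\<lambda>q. (cmod (u q * \<nu> q))\<^sup>2) \<in> borel_measurable ?M" using m by measurable
    show "AE q in ?M. norm ((cmod (u q * \<nu> q))\<^sup>2) \<le> norm (B\<^sup>2 * (cmod (u q))\<^sup>2)"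
      using sq by (intro AE_I2) simp
  qed
  show "in_L1_L2 l (\<lambda>q. u q * \<nu> q)" using 1 2 by (simp add: in_L1_L2_def)
  have "energy l (\<lambda>q. u q * \<nu> q) \<le> (LINT q|?M. B\<^sup>2 * (cmod (u q))\<^sup>2)"
    unfolding energy_def by (rule integral_mono[OF 2]) (use i sq in auto)
  then show "energy l (\<lambda>q. u q * \<nu> q) \<le> B\<^sup>2 * energy l u" by (simp add: energy_def)
qed

definition op_bound :: "real \<Rightarrow> real" where
  "op_bound S = 1 / (2 * pi) * sqrt (pi / l * S)"

lemma op_bound_nonneg: "0 \<le> S \<Longrightarrow> 0 \<le> op_bound S"
  using l by (simp add: op_bound_def)

text \<open>
  The multiplier bound becomes an operator bound on bounded functions, because the energy
  of \<open>u \<nu>\<close> is at most \<open>(sup |\<nu>|)\<^sup>2\<close> times that of \<open>u\<close>.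
\<close>
lemma potential_multiplier_bound:
  assumes \<nu>: "strip_measurable \<nu>" and B: "\<And>p. p \<in> Strip l \<Longrightarrow> cmod (\<nu> p) \<le> B" and B0: "0 \<le> B"
    and q: "square_bounded S q"
  shows "cmod (multiplier l q (\<lambda>p. u p * \<nu> p) p) \<le> op_bound S * sqrt (energy l u) * B"
proof -
  note f = potential_mult[OF \<nu> B]
  have S: "0 \<le> S" using q by (simp add: square_bounded_def)
  have "cmod (multiplier l q (\<lambda>p. u p * \<nu> p) p) \<le> op_bound S * sqrt (energy l (\<lambda>p. u p * \<nu> p))"
    using multiplier_bounds(4)[OF l f(1) q] by (simp add: op_bound_def)
  also have "\<dots> \<le> op_bound S * sqrt (B\<^sup>2 * energy l u)"
    by (intro mult_left_mono real_sqrt_le_mono f(2) op_bound_nonneg S)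
  also have "\<dots> = op_bound S * sqrt (energy l u) * B"
    using B0 by (simp add: real_sqrt_mult)
  finally show ?thesis .
qed

lemma op_bound_scale: "0 \<le> b \<Longrightarrow> op_bound (b\<^sup>2 * S) = b * op_bound S"
  by (simp add: op_bound_def real_sqrt_mult real_sqrt_divide)

lemma resolvent_diff:
  assumes "strip_measurable \<nu>" "bounded (\<nu> ` Strip l)" "strip_measurable \<nu>'" "bounded (\<nu>' ` Strip l)"
    and q: "square_bounded S (\<lambda>m \<xi>. 1 / P l z m \<xi>)"
  shows "resolvent l u z (\<lambda>q. \<nu> q - \<nu>' q) p = resolvent l u z \<nu> p - resolvent l u z \<nu>' p"
proof -
  obtain B B' where "\<And>p. p \<in> Strip l \<Longrightarrow> cmod (\<nu> p) \<le> B" "\<And>p. p \<in> Strip l \<Longrightarrow> cmod (\<nu>' p) \<le> B'"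
    using assms(2,4) unfolding bounded_iff by blast
  then have "in_L1_L2 l (\<lambda>q. u q * \<nu> q)" "in_L1_L2 l (\<lambda>q. u q * \<nu>' q)"
    using potential_mult(1) assms(1,3) by blast+
  from multiplier_diff[OF l this q] show ?thesis
    by (simp add: resolvent_def right_diff_distrib)
qed

lemma resolvent_cmult:
  assumes "strip_measurable \<nu>" "bounded (\<nu> ` Strip l)"
  shows "resolvent l u z (\<lambda>q. c * \<nu> q) p = c * resolvent l u z \<nu> p"
proof -
  obtain B where "\<And>p. p \<in> Strip l \<Longrightarrow> cmod (\<nu> p) \<le> B"
    using assms(2) unfolding bounded_iff by blast
  then have "in_L1_L2 l (\<lambda>q. u q * \<nu> q)"
    using potential_mult(1) assms(1) by blast
  from multiplier_cmult[OF l this, of "\<lambda>m \<xi>. 1 / P l z m \<xi>" c] show ?thesis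
    by (simp add: resolvent_def mult_ac)
qed

end

text \<open>
  A parameter \<open>z0\<close> at which \<open>|Re P|\<close> dominates \<open>d m\<^sup>2\<close>. The constants \<open>d\<close> and \<open>S\<close> are
  carried along so that all later estimates can be expressed through them.
\<close>
locale regular_parameter = strip_potential +
  fixes z0 :: complex and d S :: real
  assumes d: "d > 0"
    and gap: "\<And>m \<xi>. m \<noteq> 0 \<Longrightarrow> d * (of_int m)\<^sup>2 \<le> \<bar>Re (P l z0 m \<xi>)\<bar>"
    and S: "square_bounded S (\<lambda>m \<xi>. 1 / P l z0 m \<xi>)"
begin

abbreviation T :: "(real \<times> real \<Rightarrow> complex) \<Rightarrow> real \<times> real \<Rightarrow> complex" where
  "T \<equiv> resolvent l u z0"

lemma S_nonneg: "0 \<le> S" using S by (simp add: square_bounded_def)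

text \<open>
  The increment of \<open>T \<nu>\<close> under a translation by \<open>h\<close> is the multiplier with symbol
  \<open>(wave(h) - 1) / P\<close>, whose norm is small uniformly in \<open>\<nu>\<close> and in the base point.
\<close>
lemma resolvent_equicontinuous:
  assumes \<epsilon>: "\<epsilon> > 0"
  shows "\<exists>\<delta>>0. \<forall>\<nu> p h. strip_measurable \<nu> \<longrightarrow> (\<forall>p\<in>Strip l. cmod (\<nu> p) \<le> 1) \<longrightarrow> norm h < \<delta> \<longrightarrow>
    cmod (T \<nu> (p + h) - T \<nu> p) \<le> \<epsilon>"
proof -
  define C where "C = op_bound 1 * sqrt (energy l u)"
  have C: "0 \<le> C" by (simp add: C_def op_bound_nonneg)
  \<comment> \<open>\<open>C + 1\<close> rather than \<open>C\<close>, since the potential may vanish.\<close>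
  define b where "b = \<epsilon> / (C + 1)"
  have b: "b > 0" using \<epsilon> C by (simp add: b_def)
  then have b2: "b\<^sup>2 > 0" by simp
  have "\<exists>\<delta>>0. \<forall>h. norm h < \<delta> \<longrightarrow>
      square_bounded (b\<^sup>2) (\<lambda>m \<xi>. 1 / P l z0 m \<xi> * (plane_wave l m \<xi> h - 1))"
    by (rule translated_symbol_small[OF l d _ b2]) (rule gap)
  then obtain \<delta> where \<delta>: "\<delta> > 0"
    "\<And>h. norm h < \<delta> \<Longrightarrow> square_bounded (b\<^sup>2) (\<lambda>m \<xi>. 1 / P l z0 m \<xi> * (plane_wave l m \<xi> h - 1))"
    by blast
  show ?thesis
  proof (intro exI[of _ \<delta>] conjI \<delta>(1) allI impI)
    fix \<nu> and p h :: "real \<times> real" assume \<nu>: "strip_measurable \<nu>" "\<forall>p\<in>Strip l. cmod (\<nu> p)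
        \<le> 1" and h: "norm h < \<delta>"
    let ?f = "\<lambda>q. u q * \<nu> q"
    have f: "in_L1_L2 l ?f" using potential_mult(1)[OF \<nu>(1)] \<nu>(2) by blast
    have sh: "square_bounded (1\<^sup>2 * S) (\<lambda>m \<xi>. 1 / P l z0 m \<xi> * plane_wave l m \<xi> h)"
      by (rule square_bounded_dominated[OF S]) (auto simp: norm_mult norm_divide)
    have "T \<nu> (p + h) - T \<nu> p = multiplier l (\<lambda>m \<xi>. 1 / P l z0 m \<xi> * plane_wave l m \<xi> h
        - 1 / P l z0 m \<xi>) ?f p"
      unfolding resolvent_def multiplier_translate by
          (rule multiplier_symbol_diff[OF l f sh S, symmetric])
    also have "\<dots> = multiplier l (\<lambda>m \<xi>. 1 / P l z0 m \<xi> * (plane_wave l m \<xi> h - 1)) ?f p"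
      by (simp only: right_diff_distrib mult_1_right)
    also have "cmod \<dots> \<le> op_bound (b\<^sup>2) * sqrt (energy l u) * 1"
      using \<nu> by (intro potential_multiplier_bound \<delta>(2) h) auto
    also have "\<dots> = b * C"
      using op_bound_scale[of b 1] b by (simp add: C_def)
    also have "\<dots> \<le> \<epsilon>"
      using C \<epsilon> by (simp add: b_def field_simps)
    finally show "cmod (T \<nu> (p + h) - T \<nu> p) \<le> \<epsilon>" .
  qed
qed

lemma resolvent_compact:
  fixes w :: "nat \<Rightarrow> real \<times> real \<Rightarrow> complex"
  assumes w: "\<And>n. strip_measurable (w n)" "\<And>n p. p \<in> Strip l \<Longrightarrow> cmod (w n p) \<le> 1"
  obtains r g where "strict_mono r" "\<And>p. (\<lambda>n. T (w (r n)) p) \<longlonglongrightarrow> g p"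
proof (rule equicontinuous_convergent_subsequence[where G = "\<lambda>n. T (w n)" and M
    = "op_bound S * sqrt (energy l u) * 1"])
  show "cmod (T (w n) p) \<le> op_bound S * sqrt (energy l u) * 1" for n p
    unfolding resolvent_def by (rule potential_multiplier_bound[OF w]) (auto intro: S)
  fix \<epsilon> :: real assume "\<epsilon> > 0"
  from resolvent_equicontinuous[OF this] obtain \<delta> where \<delta>: "\<delta> > 0"
    and *: "\<And>\<nu> p h. strip_measurable \<nu> \<Longrightarrow> \<forall>p\<in>Strip l. cmod (\<nu> p) \<le> 1 \<Longrightarrow> norm h < \<delta> \<Longrightarrow>
      cmod (T \<nu> (p + h) - T \<nu> p) \<le> \<epsilon>"
    by blast
  show "\<exists>\<delta>>0. \<forall>n p h. norm h < \<delta> \<longrightarrow> cmod (T (w n) (p + h) - T (w n) p) \<le> \<epsilon>"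
    by (intro exI[of _ \<delta>] conjI allI impI \<delta> *) (use w in auto)
qed (rule that)

text \<open>
  Dominated convergence with majorant \<open>4 |u|\<^sup>2\<close> gives \<open>u w\<^sub>n \<rightarrow> u g\<close> in \<open>L\<^sup>2\<close>, and the
  pointwise value of \<open>T\<close> is controlled by that norm. This is where an \<open>L\<^sup>2\<close> bound is
  stronger than a supremum bound: it replaces any decay of \<open>T w\<^sub>n\<close> at infinity.
\<close>
lemma resolvent_pointwise_to_uniform:
  fixes w :: "nat \<Rightarrow> real \<times> real \<Rightarrow> complex"
  assumes w: "\<And>n. strip_measurable (w n)" "\<And>n p. p \<in> Strip l \<Longrightarrow> cmod (w n p) \<le> 1"
    and g: "\<And>p. p \<in> Strip l \<Longrightarrow> (\<lambda>n. w n p) \<longlonglongrightarrow> g p"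
  obtains e where "e \<longlonglongrightarrow> (0::real)" "\<And>n p. cmod (T (w n) p - T g p) \<le> e n"
    "strip_measurable g" "\<And>p. p \<in> Strip l \<Longrightarrow> cmod (g p) \<le> 1"
proof -
  let ?M = "lebesgue_on (Strip l)"
  have gm: "strip_measurable g"
    by (rule borel_measurable_LIMSEQ_metric[OF w(1)]) (use g in simp)
  have g1: "cmod (g p) \<le> 1" if "p \<in> Strip l" for p
    using tendsto_norm[OF g[OF that]] by (rule LIMSEQ_le_const2) (use w(2)[OF that] in auto)
  have dm: "strip_measurable (\<lambda>p. w n p - g p)" for n
    by (rule borel_measurable_diff[OF w(1) gm])
  have d2: "cmod (w n p - g p) \<le> 2" if "p \<in> Strip l" for n p
    using norm_triangle_ineq4[of "w n p" "g p"] w(2)[OF that, of n] g1[OF that] by linarith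
  note um = potential_mult[OF dm d2]
  have "(\<lambda>n. energy l (\<lambda>q. u q * (w n q - g q))) \<longlonglongrightarrow> (LINT q|?M. 0)"
    unfolding energy_def
  proof (rule integral_dominated_convergence)
    show "integrable ?M (\<lambda>q. 4 * (cmod (u q))\<^sup>2)" using u by (simp add: in_L1_L2_def)
    show "(\<lambda>q. (cmod (u q * (w n q - g q)))\<^sup>2) \<in> borel_measurable ?M" for n
      using um(1) by (auto simp: in_L1_L2_def)
    show "AE q in ?M. (\<lambda>n. (cmod (u q * (w n q - g q)))\<^sup>2) \<longlonglongrightarrow> 0"
    proof (rule AE_I2)
      fix q assume "q \<in> space ?M"
      then have "(\<lambda>n. (cmod (u q * (w n q - g q)))\<^sup>2) \<longlonglongrightarrow> (cmod (u q * (g q - g q)))\<^sup>2"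
        by (intro tendsto_intros g) simp
      then show "(\<lambda>n. (cmod (u q * (w n q - g q)))\<^sup>2) \<longlonglongrightarrow> 0" by simp
    qed
    show "AE q in ?M. norm ((cmod (u q * (w n q - g q)))\<^sup>2) \<le> 4 * (cmod (u q))\<^sup>2" for n
    proof (rule AE_I2)
      fix q assume "q \<in> space ?M"
      then have "(cmod (w n q - g q))\<^sup>2 \<le> 2\<^sup>2" by (intro power_mono d2) auto
      then have "(cmod (w n q - g q))\<^sup>2 * (cmod (u q))\<^sup>2 \<le> 4 * (cmod (u q))\<^sup>2"
        by (intro mult_right_mono) auto
      then show "norm ((cmod (u q * (w n q - g q)))\<^sup>2) \<le> 4 * (cmod (u q))\<^sup>2"
        by (simp add: norm_mult power_mult_distrib mult.commute)
    qed
  qed simp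
  then have "(\<lambda>n. op_bound S * sqrt (energy l (\<lambda>q. u q * (w n q - g q)))) \<longlonglongrightarrow> op_bound S * sqrt 0"
    by (intro tendsto_intros) simp
  moreover have "cmod (T (w n) p - T g p) \<le> op_bound S * sqrt (energy l (\<lambda>q. u q * (w n q
      - g q)))" for n p
  proof -
    have "bounded (w n ` Strip l)" "bounded (g ` Strip l)"
      unfolding bounded_iff using w(2) g1 by blast+
    then have "T (w n) p - T g p = T (\<lambda>q. w n q - g q) p"
      using resolvent_diff[OF w(1) _ gm _ S] by simp
    then show ?thesis
      using multiplier_bounds(4)[OF l um(1) S] by (simp add: resolvent_def op_bound_def)
  qed
  ultimately show ?thesis using that[of "\<lambda>n. op_bound S * sqrt (energy l (\<lambda>q. u q * (w n q
      - g q)))"] gm g1 by simp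
qed

definition bounded_below :: "real \<Rightarrow> bool" where
  "bounded_below \<kappa> \<longleftrightarrow> (\<forall>\<nu> \<epsilon>. strip_measurable \<nu> \<longrightarrow> bounded (\<nu> ` Strip l) \<longrightarrow>
    (\<forall>p\<in>Strip l. cmod (\<nu> p - T \<nu> p) \<le> \<epsilon>) \<longrightarrow> (\<forall>p\<in>Strip l. cmod (\<nu> p) \<le> \<kappa> * \<epsilon>))"

text \<open>
  Half of the Fredholm alternative: for a compact \<open>T\<close>, injectivity of \<open>1 - T\<close> implies that
  \<open>1 - T\<close> is bounded below. Injectivity is assumed on periodic functions, since the limit
  function constructed in the proof equals its own image under \<open>T\<close> and images are
  periodic.
\<close>
lemma resolvent_bounded_below:
  assumes injective: "\<And>\<nu>. strip_measurable \<nu> \<Longrightarrow> bounded (\<nu> ` Strip l) \<Longrightarrow> x_periodic l \<nu> \<Longrightarrow>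
      (\<And>p. p \<in> Strip l \<Longrightarrow> \<nu> p = T \<nu> p) \<Longrightarrow> (\<And>p. p \<in> Strip l \<Longrightarrow> \<nu> p = 0)"
  shows "\<exists>\<kappa>>0. bounded_below \<kappa>"
proof -
  define bad where "bad \<kappa> \<nu> \<epsilon> p \<longleftrightarrow> strip_measurable \<nu> \<and> bounded (\<nu> ` Strip l) \<and>
    (\<forall>p\<in>Strip l. cmod (\<nu> p - T \<nu> p) \<le> \<epsilon>) \<and> p \<in> Strip l \<and> \<not> cmod (\<nu> p) \<le> \<kappa> * \<epsilon>" for \<kappa> \<nu> \<epsilon> p
  have "\<exists>\<kappa>>0. \<forall>\<nu> \<epsilon> p. \<not> bad \<kappa> \<nu> \<epsilon> p"
  proof (rule ccontr)
    assume neg: "\<not> ?thesis"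
    have "\<exists>w. strip_measurable w \<and> (\<forall>p\<in>Strip l. cmod (w p) \<le> 1) \<and> (\<exists>p\<in>Strip l. 1 / 2 < cmod (w p)) \<and>
        (\<forall>p\<in>Strip l. cmod (w p - T w p) \<le> 1 / real (Suc n))" for n
    proof -
      have "real (Suc n) > 0" by simp
      then obtain \<nu> \<epsilon> p where "bad (real (Suc n)) \<nu> \<epsilon> p" using neg by blast
      then have \<nu>: "strip_measurable \<nu>" "bounded (\<nu> ` Strip l)" and \<epsilon>: "\<And>p. p \<in> Strip l \<Longrightarrow>
          cmod (\<nu> p - T \<nu> p) \<le> \<epsilon>"
        and p: "p \<in> Strip l" "real (Suc n) * \<epsilon> < cmod (\<nu> p)"
        by (auto simp: bad_def)
      \<comment> \<open>Normalize to supremum one; the defect shrinks to at most \<open>1 / (n + 1)\<close>.\<close>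
      define s where "s = (SUP p\<in>Strip l. cmod (\<nu> p))"
      have bdd: "bdd_above ((\<lambda>p. cmod (\<nu> p)) ` Strip l)"
        using \<nu>(2) by (auto simp: bounded_iff bdd_above_def)
      have le: "cmod (\<nu> p) \<le> s" if "p \<in> Strip l" for p
        unfolding s_def by (rule cSUP_upper[OF that bdd])
      have "0 \<le> \<epsilon>" using \<epsilon>[OF p(1)] norm_ge_zero order_trans by blast
      then have "0 \<le> real (Suc n) * \<epsilon>" by simp
      then have s: "s > 0" "real (Suc n) * \<epsilon> < s" using p(2) le[OF p(1)] by linarith+
      then have "s / 2 < s" by simp
      then obtain p' where p': "p' \<in> Strip l" "s / 2 < cmod (\<nu> p')"
        unfolding s_def using less_cSUP_iff[OF _ bdd] p(1) by blast
      define w where "w p = of_real (1 / s) * \<nu> p" for p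
      have wn: "cmod (w p) = cmod (\<nu> p) / s" for p using s by (simp add: w_def norm_mult norm_divide)
      have Tw: "w p - T w p = of_real (1 / s) * (\<nu> p - T \<nu> p)" for p
        unfolding w_def[abs_def] resolvent_cmult[OF \<nu>] by (simp add: algebra_simps)
      have "cmod (w p - T w p) \<le> 1 / real (Suc n)" if "p \<in> Strip l" for p
      proof -
        have "cmod (w p - T w p) = cmod (\<nu> p - T \<nu> p) / s"
          unfolding Tw using s by (simp add: norm_mult norm_divide)
        also have "\<dots> \<le> \<epsilon> / s" using \<epsilon>[OF that] s by (simp add: divide_right_mono)
        also have "\<dots> \<le> 1 / real (Suc n)" using s by (simp add: field_simps)
        finally show ?thesis .
      qed
      moreover have "strip_measurable w" unfolding w_def[abs_def] by
          (intro borel_measurable_times \<nu>(1)) simp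
      moreover have "cmod (w p) \<le> 1" if "p \<in> Strip l" for p using le[OF that] s by (simp add: wn)
      moreover have "1 / 2 < cmod (w p')" using p' s by (simp add: wn field_simps)
      ultimately show ?thesis using p'(1) by blast
    qed
    then obtain w where w: "\<And>n. strip_measurable (w n)" "\<And>n p. p \<in> Strip l \<Longrightarrow> cmod (w n p) \<le> 1"
      and big: "\<And>n. \<exists>p\<in>Strip l. 1 / 2 < cmod (w n p)"
      and wT: "\<And>n p. p \<in> Strip l \<Longrightarrow> cmod (w n p - T (w n) p) \<le> 1 / real (Suc n)"
      by metis
    obtain r g where r: "strict_mono r" and g: "\<And>p. (\<lambda>n. T (w (r n)) p) \<longlonglongrightarrow> g p"
      using resolvent_compact[of w] w by blast
    have inv: "(\<lambda>n. 1 / real (Suc (r n))) \<longlonglongrightarrow> 0"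
      using LIMSEQ_subseq_LIMSEQ[OF LIMSEQ_Suc[OF lim_1_over_n] r] by (simp add: o_def)
    have wg: "(\<lambda>n. w (r n) p) \<longlonglongrightarrow> g p" if "p \<in> Strip l" for p
    proof -
      have "(\<lambda>n. w (r n) p - T (w (r n)) p) \<longlonglongrightarrow> 0"
        by (rule Lim_null_comparison[OF _ inv]) (use wT[OF that] in auto)
      from tendsto_add[OF this g[of p]] show ?thesis by simp
    qed
    obtain e where e: "e \<longlonglongrightarrow> (0::real)" "\<And>n p. cmod (T (w (r n)) p - T g p) \<le> e n"
      and gm: "strip_measurable g" and g1: "\<And>p. p \<in> Strip l \<Longrightarrow> cmod (g p) \<le> 1"
      using resolvent_pointwise_to_uniform[of "\<lambda>n. w (r n)" g] w wg by blast
    \<comment> \<open>The limit exists on the whole plane, so this holds off the strip as well and yields periodicity.\<close>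
    have fixed: "g p = T g p" for p
    proof -
      have "(\<lambda>n. T (w (r n)) p - T g p) \<longlonglongrightarrow> 0"
        by (rule Lim_null_comparison[OF _ e(1)]) (use e(2) in auto)
      from tendsto_add[OF this tendsto_const[of "T g p"]] have "(\<lambda>n. T (w (r n)) p) \<longlonglongrightarrow> T g p" by simp
      with g[of p] show ?thesis by (rule LIMSEQ_unique)
    qed
    have "x_periodic l (T g)" unfolding resolvent_def by (rule x_periodic_multiplier[OF l])
    moreover have "T g = g" using fixed by auto
    ultimately have "x_periodic l g" by simp
    moreover have "bounded (g ` Strip l)" unfolding bounded_iff using g1 by blast
    ultimately have zero: "g p = 0" if "p \<in> Strip l" for p
      using injective[OF gm _ _ fixed that] by blast
    \<comment> \<open>Hence \<open>w\<^sub>n\<close> tends to zero uniformly, although it exceeds \<open>1 / 2\<close> somewhere for every \<open>n\<close>.\<close>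
    have "(\<lambda>n. 1 / real (Suc (r n)) + e n) \<longlonglongrightarrow> 0 + 0"
      by (rule tendsto_add[OF inv e(1)])
    then have "\<forall>\<^sub>F n in sequentially. 1 / real (Suc (r n)) + e n < 1 / 2"
      by (intro order_tendstoD) auto
    then obtain n where n: "1 / real (Suc (r n)) + e n < 1 / 2"
      by (auto simp: eventually_sequentially)
    obtain p where p: "p \<in> Strip l" "1 / 2 < cmod (w (r n) p)" using big by blast
    have "T g p = 0" using zero[OF p(1)] fixed[of p] by simp
    then have "cmod (w (r n) p) \<le> cmod (w (r n) p - T (w (r n)) p) + cmod (T (w (r n)) p - T g p)"
      using norm_triangle_ineq[of "w (r n) p - T (w (r n)) p" "T (w (r n)) p - T g p"] by simp
    also have "\<dots> < 1 / 2" using wT[OF p(1), of "r n"] e(2)[of n p] n by linarith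
    finally show False using p(2) by simp
  qed
  then show ?thesis unfolding bad_def bounded_below_def by blast
qed

end

section \<open>Differentiation with respect to the parameter\<close>

text \<open>
  The quotients converge along some sequence tending to \<open>z0\<close>, and the Cauchy condition
  makes the limit independent of the approach. If \<open>z0\<close> is isolated in \<open>N\<close> there is nothing
  to prove.
\<close>
lemma field_differentiable_if_quotients_Cauchy:
  fixes h :: "complex \<Rightarrow> complex"
  assumes \<rho>: "\<rho> > 0" and C: "C \<ge> 0"
    and q: "\<And>z z'. z \<in> N \<Longrightarrow> z' \<in> N \<Longrightarrow> z \<noteq> z0 \<Longrightarrow> z' \<noteq> z0 \<Longrightarrow> cmod (z - z0) < \<rho> \<Longrightarrow> cmod (z' - z0) < \<rho> \<Longrightarrow>
      cmod ((h z - h z0) / (z - z0) - (h z' - h z0) / (z' - z0)) \<le> C * (cmod (z - z0) + cmod (z' - z0))"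
  shows "h field_differentiable (at z0 within N)"
proof (cases "z0 islimpt N")
  case False
  then have "at z0 within N = bot" by (simp add: trivial_limit_within)
  then show ?thesis by (auto simp: field_differentiable_def has_field_derivative_iff)
next
  case True
  let ?Q = "\<lambda>z. (h z - h z0) / (z - z0)"
  obtain x where x: "\<And>n. x n \<in> N - {z0}" "x \<longlonglongrightarrow> z0"
    using True unfolding islimpt_sequential by blast
  have near: "\<forall>\<^sub>F n in sequentially. cmod (x n - z0) < e" if "e > 0" for e
    using tendstoD[OF x(2) that] by (simp add: dist_norm)
  have "Cauchy (\<lambda>n. ?Q (x n))"
  proof (rule CauchyI)
    fix e :: real assume e: "e > 0"
    define \<eta> where "\<eta> = min \<rho> (e / (2 * C + 1))"
    have \<eta>: "\<eta> > 0" using \<rho> e C by (simp add: \<eta>_def)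
    obtain k where k: "\<And>n. n \<ge> k \<Longrightarrow> cmod (x n - z0) < \<eta>"
      using near[OF \<eta>] by (auto simp: eventually_sequentially)
    have "cmod (?Q (x m) - ?Q (x n)) < e" if "m \<ge> k" "n \<ge> k" for m n
    proof -
      have mn: "cmod (x m - z0) < \<eta>" "cmod (x n - z0) < \<eta>" using k that by auto
      then have "cmod (?Q (x m) - ?Q (x n)) \<le> C * (cmod (x m - z0) + cmod (x n - z0))"
        using x(1) by (intro q) (auto simp: \<eta>_def)
      also have "\<dots> \<le> C * (\<eta> + \<eta>)" using mn C by (intro mult_left_mono) auto
      also have "\<dots> = 2 * C * \<eta>" by simp
      also have "\<dots> \<le> 2 * C * (e / (2 * C + 1))" using C by (intro mult_left_mono) (auto simp: \<eta>_def)
      also have "\<dots> < e" using e C by (simp add: field_simps)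
      finally show ?thesis .
    qed
    then show "\<exists>k. \<forall>m\<ge>k. \<forall>n\<ge>k. cmod (?Q (x m) - ?Q (x n)) < e" by blast
  qed
  then obtain D where D: "(\<lambda>n. ?Q (x n)) \<longlonglongrightarrow> D"
    using Cauchy_convergent convergent_def by blast
  have QD: "cmod (?Q z - D) \<le> C * cmod (z - z0)" if z: "z \<in> N" "z \<noteq> z0" "cmod (z - z0) < \<rho>" for z
  proof (rule tendsto_le[OF trivial_limit_sequentially])
    show "(\<lambda>n. cmod (?Q z - ?Q (x n))) \<longlonglongrightarrow> cmod (?Q z - D)"
      by (intro tendsto_intros D)
    have "(\<lambda>n. C * (cmod (z - z0) + cmod (x n - z0))) \<longlonglongrightarrow> C * (cmod (z - z0) + cmod (z0 - z0))"
      by (intro tendsto_intros x(2))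
    then show "(\<lambda>n. C * (cmod (z - z0) + cmod (x n - z0))) \<longlonglongrightarrow> C * cmod (z - z0)" by simp
    show "\<forall>\<^sub>F n in sequentially. cmod (?Q z - ?Q (x n)) \<le> C * (cmod (z - z0) + cmod (x n - z0))"
      using near[OF \<rho>]
    proof eventually_elim
      fix n assume "cmod (x n - z0) < \<rho>"
      then show "cmod (?Q z - ?Q (x n)) \<le> C * (cmod (z - z0) + cmod (x n - z0))"
        using q[of z "x n"] z x(1)[of n] by blast
    qed
  qed
  have "((\<lambda>z. ?Q z - D) \<longlongrightarrow> 0) (at z0 within N)"
  proof (rule Lim_null_comparison)
    show "\<forall>\<^sub>F z in at z0 within N. norm (?Q z - D) \<le> C * cmod (z - z0)"
      unfolding eventually_at using \<rho> QD by (auto simp: dist_norm intro!: exI[of _ \<rho>])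
    have "((\<lambda>z. C * cmod (z - z0)) \<longlongrightarrow> C * cmod (z0 - z0)) (at z0 within N)"
      by (intro tendsto_intros)
    then show "((\<lambda>z. C * cmod (z - z0)) \<longlongrightarrow> 0) (at z0 within N)" by simp
  qed
  then have "(h has_field_derivative D) (at z0 within N)"
    unfolding has_field_derivative_iff by (rule LIM_zero_cancel)
  then show ?thesis by (auto simp: field_differentiable_def)
qed

text \<open>
  The derivative of \<open>1 / P\<close> with respect to \<open>z\<close>.
\<close>
definition derivative_symbol :: "real \<Rightarrow> complex \<Rightarrow> int \<Rightarrow> real \<Rightarrow> complex" where
  "derivative_symbol l z m \<xi> = - (2 * of_real (freq l) * of_int m) / (P l z m \<xi>)\<^sup>2"

text \<open>
  Since \<open>P\<close> is affine in \<open>z\<close> with slope \<open>k = 2 * freq l * m\<close>, the increments of \<open>1 / P\<close>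
  are products of the ratios \<open>k / P\<close>, one for each order, with \<open>1 / P\<^sub>z\<^sub>0\<close>. The slope
  grows like \<open>m\<close> and \<open>|P|\<close> at least like \<open>m\<^sup>2\<close>, so these ratios are bounded uniformly in
  the mode and the frequency.
\<close>
lemma symbol_expansion:
  assumes l: "l > 0" and d: "d > 0" and m: "m \<noteq> 0"
    and gap0: "d * (of_int m)\<^sup>2 \<le> \<bar>Re (P l z0 m \<xi>)\<bar>" and gap: "d * (of_int m)\<^sup>2 \<le> \<bar>Re (P l z m \<xi>)\<bar>"
  defines "symbol_rate \<equiv> 2 * freq l / d"
  shows "cmod (1 / P l z m \<xi> - 1 / P l z0 m \<xi>) \<le> symbol_rate * cmod (z - z0) * cmod (1 / P l z0 m \<xi>)"
    and "cmod (derivative_symbol l z0 m \<xi>) \<le> symbol_rate * cmod (1 / P l z0 m \<xi>)"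
    and "cmod (1 / P l z m \<xi> - 1 / P l z0 m \<xi> - (z - z0) * derivative_symbol l z0 m \<xi>)
      \<le> (symbol_rate * cmod (z - z0))\<^sup>2 * cmod (1 / P l z0 m \<xi>)"
proof -
  define a b k where "a = P l z0 m \<xi>" and "b = P l z m \<xi>" and "k
      = 2 * complex_of_real (freq l) * of_int m"
  define t where "t = z - z0"
  have w: "freq l > 0" by (rule freq_times(2)[OF l])
  have dm: "d * (of_int m)\<^sup>2 > 0" using d m by simp
  have ratio: "cmod (k / c) \<le> symbol_rate \<and> c \<noteq> 0" if "d * (of_int m)\<^sup>2 \<le> \<bar>Re c\<bar>" for c
  proof -
    have c: "d * (of_int m)\<^sup>2 \<le> cmod c" using that abs_Re_le_cmod[of c] by linarith
    have "cmod c > 0" using c dm by linarith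
    then have "cmod (k / c) \<le> 2 * freq l * \<bar>of_int m\<bar> / (d * (of_int m)\<^sup>2)"
      using dm w c by (auto simp: k_def norm_mult norm_divide intro!: divide_left_mono mult_pos_pos)
    also have "\<dots> = symbol_rate * (1 / \<bar>of_int m\<bar>)"
      using m by (auto simp: symbol_rate_def power2_eq_square abs_if field_simps)
    also have "\<dots> \<le> symbol_rate * 1"
    proof (rule mult_left_mono)
      have "1 \<le> \<bar>m\<bar>" using m by simp
      then have "1 \<le> \<bar>real_of_int m\<bar>" by linarith
      then show "1 / \<bar>real_of_int m\<bar> \<le> 1" by simp
      show "0 \<le> symbol_rate" using w d by (simp add: symbol_rate_def)
    qed
    finally show ?thesis using c dm by auto
  qed
  have a: "cmod (k / a) \<le> symbol_rate" "a \<noteq> 0" using ratio[of a] gap0 by (auto simp: a_def)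
  have b: "cmod (k / b) \<le> symbol_rate" "b \<noteq> 0" using ratio[of b] gap by (auto simp: b_def)
  have ba: "b = a + k * t" using P_diff[of l z m \<xi> z0] by
      (simp add: a_def b_def k_def t_def algebra_simps)
  have D: "derivative_symbol l z0 m \<xi> = - k / a\<^sup>2" by (simp add: derivative_symbol_def a_def k_def)
  have "1 / b - 1 / a = - (k / b) * t * (1 / a)"
    using a(2) b(2) ba by (simp add: field_simps)
  then have "cmod (1 / b - 1 / a) = cmod (k / b) * cmod t * cmod (1 / a)"
    by (simp only: norm_mult norm_minus_cancel)
  also have "\<dots> \<le> symbol_rate * cmod t * cmod (1 / a)"
    by (intro mult_right_mono b) auto
  finally show "cmod (1 / P l z m \<xi> - 1 / P l z0 m \<xi>)
      \<le> symbol_rate * cmod (z - z0) * cmod (1 / P l z0 m \<xi>)"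
    by (simp add: a_def b_def t_def)
  have "cmod (- k / a\<^sup>2) = cmod (k / a) * cmod (1 / a)"
    by (simp add: norm_divide norm_mult power2_eq_square)
  also have "\<dots> \<le> symbol_rate * cmod (1 / a)"
    by (intro mult_right_mono a) auto
  finally show "cmod (derivative_symbol l z0 m \<xi>) \<le> symbol_rate * cmod (1 / P l z0 m \<xi>)"
    unfolding D by (simp add: a_def)
  have "1 / b - 1 / a - t * (- k / a\<^sup>2) = (k / a) * t * ((k / b) * t) * (1 / a)"
  proof -
    have kt: "k * t = b - a" using ba by simp
    have "1 / b - 1 / a - t * (- k / a\<^sup>2) = 1 / b - 1 / a + (k * t) / a\<^sup>2" by simp
    also have "\<dots> = (k * t) * (k * t) / (a * a * b)"
      unfolding kt using a(2) b(2) by (simp add: field_simps power2_eq_square)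
    finally show ?thesis by simp
  qed
  then have "cmod (1 / b - 1 / a - t * (- k / a\<^sup>2))
      = cmod (k / a) * cmod t * (cmod (k / b) * cmod t) * cmod (1 / a)"
    by (simp only: norm_mult)
  also have "\<dots> \<le> symbol_rate * cmod t * (symbol_rate * cmod t) * cmod (1 / a)"
    by (intro mult_right_mono mult_mono a b) (use order_trans[OF norm_ge_zero a(1)] in auto)
  finally show "cmod (1 / P l z m \<xi> - 1 / P l z0 m \<xi> - (z - z0) * derivative_symbol l z0 m \<xi>)
      \<le> (symbol_rate * cmod (z - z0))\<^sup>2 * cmod (1 / P l z0 m \<xi>)"
    unfolding D by (simp add: a_def b_def t_def power2_eq_square)
qed

context regular_parameter
begin

definition symbol_rate :: real where "symbol_rate = 2 * freq l / d"

text \<open>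
  By \<open>potential_multiplier_bound\<close> this bounds the norm of \<open>T\<close> on bounded functions; a
  symbol of modulus at most \<open>b / |P|\<close> gives an operator of norm at most \<open>b\<close> times this.
\<close>
definition resolvent_bound :: real where "resolvent_bound = op_bound S * sqrt (energy l u)"

text \<open>
  The derivative of \<open>z \<mapsto> T\<^sub>z\<close> at \<open>z0\<close>.
\<close>
definition T' :: "(real \<times> real \<Rightarrow> complex) \<Rightarrow> real \<times> real \<Rightarrow> complex" where
  "T' \<nu> = multiplier l (derivative_symbol l z0) (\<lambda>q. u q * \<nu> q)"

lemma symbol_rate_nonneg: "0 \<le> symbol_rate" and resolvent_bound_nonneg: "0 \<le> resolvent_bound"
  using freq_times(2)[OF l] d op_bound_nonneg[OF S_nonneg] by
      (simp_all add: symbol_rate_def resolvent_bound_def)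

lemma dominated_multiplier_bound:
  assumes \<nu>: "strip_measurable \<nu>" and B: "\<And>p. p \<in> Strip l \<Longrightarrow>
      cmod (\<nu> p) \<le> B" and B0: "0 \<le> B" and b: "0 \<le> b"
    and r: "\<And>m. r m \<in> borel_measurable borel" "\<And>m \<xi>. m \<noteq> 0 \<Longrightarrow> cmod (r m \<xi>) \<le> b * cmod (1 / P l z0 m \<xi>)"
  shows "cmod (multiplier l r (\<lambda>q. u q * \<nu> q) p) \<le> b * resolvent_bound * B"
  using potential_multiplier_bound[OF \<nu> B B0 square_bounded_dominated[OF S r(1) b r(2)]]
  by (simp add: op_bound_scale[OF b] resolvent_bound_def mult.assoc)

lemma derivative_symbol_borel: "derivative_symbol l z0 m \<in> borel_measurable borel"
  unfolding derivative_symbol_def[abs_def] by measurable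

lemma derivative_symbol_bound: "m \<noteq> 0 \<Longrightarrow> cmod (derivative_symbol l z0 m \<xi>)
    \<le> symbol_rate * cmod (1 / P l z0 m \<xi>)"
  unfolding symbol_rate_def by (rule symbol_expansion(2)[OF l d _ gap gap])

lemma T'_bound:
  assumes "strip_measurable \<nu>" "\<And>p. p \<in> Strip l \<Longrightarrow> cmod (\<nu> p) \<le> B" "0 \<le> B"
  shows "cmod (T' \<nu> p) \<le> symbol_rate * resolvent_bound * B"
  unfolding T'_def by (rule dominated_multiplier_bound[OF assms symbol_rate_nonneg
      derivative_symbol_borel derivative_symbol_bound])

lemma T'_diff:
  assumes "strip_measurable \<nu>" "bounded (\<nu> ` Strip l)" "strip_measurable \<nu>'" "bounded (\<nu>' ` Strip l)"
  shows "T' (\<lambda>q. \<nu> q - \<nu>' q) p = T' \<nu> p - T' \<nu>' p"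
proof -
  obtain B B' where "\<And>p. p \<in> Strip l \<Longrightarrow> cmod (\<nu> p) \<le> B" "\<And>p. p \<in> Strip l \<Longrightarrow> cmod (\<nu>' p) \<le> B'"
    using assms(2,4) unfolding bounded_iff by blast
  then have "in_L1_L2 l (\<lambda>q. u q * \<nu> q)" "in_L1_L2 l (\<lambda>q. u q * \<nu>' q)"
    using potential_mult(1) assms(1,3) by blast+
  from multiplier_diff[OF l this square_bounded_dominated[OF S derivative_symbol_borel
      symbol_rate_nonneg derivative_symbol_bound]]
  show ?thesis by (simp add: T'_def right_diff_distrib)
qed

text \<open>
  The Taylor estimates of the symbol carry over to the operators, since each error symbol
  is dominated by \<open>1 / P\<close> at \<open>z0\<close>.
\<close>
lemma resolvent_expansion:
  assumes gapz: "\<And>m \<xi>. m \<noteq> 0 \<Longrightarrow> d * (of_int m)\<^sup>2 \<le> \<bar>Re (P l z m \<xi>)\<bar>"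
    and \<nu>: "strip_measurable \<nu>" and B: "\<And>p. p \<in> Strip l \<Longrightarrow> cmod (\<nu> p) \<le> B" and B0: "0 \<le> B"
  shows "cmod (resolvent l u z \<nu> p - T \<nu> p) \<le> symbol_rate * cmod (z - z0) * resolvent_bound * B"
    and "cmod (resolvent l u z \<nu> p - T \<nu> p - (z - z0) * T' \<nu> p)
        \<le> (symbol_rate * cmod (z - z0))\<^sup>2 * resolvent_bound * B"
proof -
  let ?f = "\<lambda>q. u q * \<nu> q"
  note f = potential_mult(1)[OF \<nu> B]
  obtain S' where Sz: "square_bounded S' (\<lambda>m \<xi>. 1 / P l z m \<xi>)"
    using inverse_symbol_square_bounded[OF l d gapz] by blast
  note exp = symbol_expansion[OF l d _ gap gapz, folded symbol_rate_def]
  have Lz: "0 \<le> symbol_rate * cmod (z - z0)" using symbol_rate_nonneg by simp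
  have b1: "(\<lambda>\<xi>. 1 / P l z m \<xi> - 1 / P l z0 m \<xi>) \<in> borel_measurable borel" for m by measurable
  have S1: "square_bounded ((symbol_rate * cmod (z - z0))\<^sup>2 * S) (\<lambda>m \<xi>. 1 / P l z m \<xi> - 1 / P l z0 m \<xi>)"
    by (rule square_bounded_dominated[OF S b1 Lz exp(1)])
  have SD: "square_bounded (symbol_rate\<^sup>2 * S) (derivative_symbol l z0)"
    by (rule square_bounded_dominated[OF S derivative_symbol_borel symbol_rate_nonneg
        derivative_symbol_bound])
  have bD: "(\<lambda>\<xi>. (z - z0) * derivative_symbol l z0 m \<xi>) \<in> borel_measurable borel" for m
    using derivative_symbol_borel by measurable
  have SzD: "square_bounded ((cmod (z - z0))\<^sup>2 * (symbol_rate\<^sup>2 * S)) (\<lambda>m \<xi>. (z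
      - z0) * derivative_symbol l z0 m \<xi>)"
    by (rule square_bounded_dominated[OF SD bD]) (simp_all add: norm_mult)
  have one: "resolvent l u z \<nu> p - T \<nu> p = multiplier l (\<lambda>m \<xi>. 1 / P l z m \<xi> - 1 / P l z0 m \<xi>) ?f p"
    unfolding resolvent_def by (rule multiplier_symbol_diff[OF l f Sz S, symmetric])
  show "cmod (resolvent l u z \<nu> p - T \<nu> p) \<le> symbol_rate * cmod (z - z0) * resolvent_bound * B"
    unfolding one by (rule dominated_multiplier_bound[OF \<nu> B B0 Lz b1 exp(1)])
  have two: "resolvent l u z \<nu> p - T \<nu> p - (z - z0) * T' \<nu> p =
      multiplier l (\<lambda>m \<xi>. 1 / P l z m \<xi> - 1 / P l z0 m \<xi> - (z - z0) * derivative_symbol l z0 m \<xi>) ?f p"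
    unfolding one T'_def multiplier_symbol_cmult[symmetric]
    by (rule multiplier_symbol_diff[OF l f S1 SzD, symmetric])
  have b2: "(\<lambda>\<xi>. 1 / P l z m \<xi> - 1 / P l z0 m \<xi> - (z
      - z0) * derivative_symbol l z0 m \<xi>) \<in> borel_measurable borel" for m
    using b1 bD by (rule borel_measurable_diff)
  show "cmod (resolvent l u z \<nu> p - T \<nu> p - (z - z0) * T' \<nu> p)
      \<le> (symbol_rate * cmod (z - z0))\<^sup>2 * resolvent_bound * B"
    unfolding two by (rule dominated_multiplier_bound[OF \<nu> B B0 zero_le_power2 b2 exp(3)])
qed

text \<open>
  Near \<open>z0\<close> the increment \<open>\<mu>\<^sub>z - \<mu>\<^sub>z\<^sub>0\<close> solves \<open>(1 - T) \<nu> = (T\<^sub>z - T) \<mu>\<^sub>z\<close>. The lower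
  bound for \<open>1 - T\<close> turns this first into a Lipschitz estimate and then, after division by
  \<open>z - z0\<close>, into a Cauchy condition: the right-hand sides converge to \<open>T' \<mu>\<^sub>z\<^sub>0\<close> at a
  linear rate.
\<close>
lemma solution_differentiable:
  assumes \<kappa>: "\<kappa> > 0"
    and bb: "bounded_below \<kappa>"
    and r: "r > 0" and gapz: "\<And>z m \<xi>. cmod (z - z0) < r \<Longrightarrow> m \<noteq> 0 \<Longrightarrow> d * (of_int m)\<^sup>2 \<le> \<bar>Re (P l z m \<xi>)\<bar>"
    and sol: "\<And>z. z \<in> N \<Longrightarrow> bounded_solution l u z (\<mu> z)" and z0: "z0 \<in> N" and p: "p \<in> Strip l"
  shows "(\<lambda>z. \<mu> z p) field_differentiable (at z0 within N)"
proof -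
  have below: "cmod (\<nu> q) \<le> \<kappa> * \<epsilon>"
    if "strip_measurable \<nu>" "bounded (\<nu> ` Strip l)" "\<And>p. p \<in> Strip l \<Longrightarrow>
        cmod (\<nu> p - T \<nu> p) \<le> \<epsilon>" "q \<in> Strip l"
    for \<nu> \<epsilon> q
    using bb that unfolding bounded_below_def by blast
  have meas: "strip_measurable (\<mu> z)" and bdd: "bounded (\<mu> z ` Strip l)"
    and eq: "\<And>p. p \<in> Strip l \<Longrightarrow> \<mu> z p = 1 + resolvent l u z (\<mu> z) p" if "z \<in> N" for z
    using sol[OF that] by (auto simp: bounded_solution_iff)
  obtain M0 where M0: "\<And>p. p \<in> Strip l \<Longrightarrow> cmod (\<mu> z0 p) \<le> M0"
    using bdd[OF z0] unfolding bounded_iff by blast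
  have M0': "0 \<le> M0" using M0[OF p] norm_ge_zero order_trans by blast
  define M where "M = 2 * M0"
  have M: "0 \<le> M" "M0 \<le> M" using M0' by (simp_all add: M_def)
  define K where "K = \<kappa> * symbol_rate * resolvent_bound"
  have K: "0 \<le> K" using \<kappa> symbol_rate_nonneg resolvent_bound_nonneg by (simp add: K_def)
  \<comment> \<open>This radius makes \<open>K |z - z0| \<le> 1 / 2\<close>, so that the bound for \<open>\<mu>\<^sub>z\<close> absorbs itself below.\<close>
  define \<rho> where "\<rho> = min r (1 / (2 * K + 1))"
  have \<rho>: "\<rho> > 0" using r K by (simp add: \<rho>_def)
  have diff_meas: "strip_measurable (\<lambda>q. \<mu> z q - \<mu> z0 q)" if "z \<in> N" for z
    by (rule borel_measurable_diff[OF meas[OF that] meas[OF z0]])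
  have diff_bdd: "bounded ((\<lambda>q. \<mu> z q - \<mu> z0 q) ` Strip l)" if "z \<in> N" for z
    by (rule bounded_minus_comp[OF bdd[OF that] bdd[OF z0]])
  have increment: "(\<mu> z q - \<mu> z0 q) - T (\<lambda>q. \<mu> z q - \<mu> z0 q) q = resolvent l u z (\<mu> z) q - T (\<mu> z) q"
    if "z \<in> N" "q \<in> Strip l" for z q
    using eq[OF that] eq[OF z0 that(2)] resolvent_diff[OF meas[OF that(1)] bdd[OF that(1)] meas[OF
        z0] bdd[OF z0] S, of q]
    by simp
  have close: "cmod (\<mu> z q - \<mu> z0 q) \<le> K * cmod (z - z0) * B"
    if z: "z \<in> N" "cmod (z - z0) < \<rho>" and q: "q \<in> Strip l" and B: "\<And>p. p \<in> Strip l \<Longrightarrow>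
        cmod (\<mu> z p) \<le> B" for z q B
  proof -
    have B0: "0 \<le> B" using B[OF q] norm_ge_zero order_trans by blast
    have zr: "cmod (z - z0) < r" using z(2) by (simp add: \<rho>_def)
    have "cmod (\<mu> z q - \<mu> z0 q) \<le> \<kappa> * (symbol_rate * cmod (z - z0) * resolvent_bound * B)"
    proof (rule below[OF diff_meas[OF z(1)] diff_bdd[OF z(1)] _ q])
      fix p assume "p \<in> Strip l"
      then show "cmod ((\<mu> z p - \<mu> z0 p) - T (\<lambda>q. \<mu> z q - \<mu> z0 q) p)
          \<le> symbol_rate * cmod (z - z0) * resolvent_bound * B"
        unfolding increment[OF z(1) \<open>p \<in> Strip l\<close>]
        by (intro resolvent_expansion(1) gapz zr meas z(1) B B0)
    qed
    then show ?thesis by (simp add: K_def mult_ac)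
  qed
  have bound: "cmod (\<mu> z q) \<le> M" if z: "z \<in> N" "cmod (z - z0) < \<rho>" and q: "q \<in> Strip l" for z q
  proof -
    define s where "s = (SUP p\<in>Strip l. cmod (\<mu> z p))"
    have bd: "bdd_above ((\<lambda>p. cmod (\<mu> z p)) ` Strip l)"
      using bdd[OF z(1)] by (auto simp: bounded_iff bdd_above_def)
    have le: "cmod (\<mu> z p) \<le> s" if "p \<in> Strip l" for p
      unfolding s_def by (rule cSUP_upper[OF that bd])
    have s0: "0 \<le> s" using le[OF q] norm_ge_zero order_trans by blast
    have "K * cmod (z - z0) \<le> K * (1 / (2 * K + 1))"
      using z(2) K by (intro mult_left_mono) (auto simp: \<rho>_def)
    also have "\<dots> \<le> 1 / 2" using K by (simp add: field_simps)
    finally have half: "K * cmod (z - z0) * s \<le> 1 / 2 * s" using s0 by (rule mult_right_mono)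
    \<comment> \<open>The supremum \<open>s\<close> is finite for each \<open>z\<close>; absorbing it makes the bound uniform in \<open>z\<close>.\<close>
    have "s \<le> M0 + 1 / 2 * s"
    proof (subst s_def, rule cSUP_least)
      show "Strip l \<noteq> {}" using q by blast
      fix p assume p: "p \<in> Strip l"
      show "cmod (\<mu> z p) \<le> M0 + 1 / 2 * s"
        using norm_triangle_ineq2[of "\<mu> z p" "\<mu> z0 p"] close[OF z p le] M0[OF p] half by linarith
    qed
    then show ?thesis using le[OF q] by (simp add: M_def)
  qed
  have Lip: "cmod (\<mu> z q - \<mu> z0 q) \<le> K * cmod (z - z0) * M"
    if "z \<in> N" "cmod (z - z0) < \<rho>" "q \<in> Strip l" for z q
    using close[OF that bound[OF that(1,2)]] .
  define W where "W z q = (\<mu> z q - \<mu> z0 q) / (z - z0)" for z q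
  have Wm: "strip_measurable (W z)" if "z \<in> N" for z
    unfolding W_def[abs_def] by (rule borel_measurable_divide[OF diff_meas[OF that]]) simp
  have Wb: "bounded (W z ` Strip l)" if z: "z \<in> N" for z
  proof -
    obtain b where b: "\<And>q. q \<in> Strip l \<Longrightarrow> cmod (\<mu> z q - \<mu> z0 q) \<le> b"
      using diff_bdd[OF z] unfolding bounded_iff by blast
    have "cmod (W z q) \<le> b / cmod (z - z0)" if q: "q \<in> Strip l" for q
      using b[OF q] by (simp add: W_def norm_divide divide_right_mono)
    then show ?thesis unfolding bounded_iff by blast
  qed
  \<comment> \<open>The first summand is the Taylor remainder of \<open>T\<^sub>z\<close>, the second replaces \<open>\<mu>\<^sub>z\<close> by \<open>\<mu>\<^sub>z\<^sub>0\<close> inside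
      \<open>T'\<close>.\<close>
  define c where "c = symbol_rate\<^sup>2 * resolvent_bound * M + symbol_rate * resolvent_bound * (K * M)"
  have c: "0 \<le> c" using symbol_rate_nonneg resolvent_bound_nonneg K M by (simp add: c_def)
  have residual: "cmod (W z q - T (W z) q - T' (\<mu> z0) q) \<le> c * cmod (z - z0)"
    if z: "z \<in> N" "z \<noteq> z0" "cmod (z - z0) < \<rho>" and q: "q \<in> Strip l" for z q
  proof -
    have zr: "cmod (z - z0) < r" using z(3) by (simp add: \<rho>_def)
    have n0: "z - z0 \<noteq> 0" "cmod (z - z0) > 0" using z(2) by auto
    have "T (W z) q = (1 / (z - z0)) * T (\<lambda>q. \<mu> z q - \<mu> z0 q) q"
      using resolvent_cmult[OF diff_meas[OF z(1)] diff_bdd[OF z(1)], of z0 "1 / (z - z0)" q]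
      by (simp add: W_def[abs_def])
    then have "W z q - T (W z) q = ((\<mu> z q - \<mu> z0 q) - T (\<lambda>q. \<mu> z q - \<mu> z0 q) q) / (z - z0)"
      by (simp add: W_def diff_divide_distrib)
    also have "\<dots> = (resolvent l u z (\<mu> z) q - T (\<mu> z) q) / (z - z0)"
      by (simp only: increment[OF z(1) q])
    finally have "W z q - T (W z) q - T' (\<mu> z0) q
      = (resolvent l u z (\<mu> z) q - T (\<mu> z) q - (z - z0) * T' (\<mu> z) q) / (z - z0) + (T' (\<mu> z) q - T'
          (\<mu> z0) q)"
      using n0(1) by (simp add: diff_divide_distrib)
    also have "cmod \<dots> \<le> (symbol_rate * cmod (z - z0))\<^sup>2 * resolvent_bound * M / cmod (z - z0)
        + symbol_rate * resolvent_bound * (K * cmod (z - z0) * M)"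
    proof (rule norm_triangle_le, rule add_mono)
      show "cmod ((resolvent l u z (\<mu> z) q - T (\<mu> z) q - (z - z0) * T' (\<mu> z) q) / (z - z0))
          \<le> (symbol_rate * cmod (z - z0))\<^sup>2 * resolvent_bound * M / cmod (z - z0)"
        unfolding norm_divide
        by (intro divide_right_mono resolvent_expansion(2) gapz zr meas bound z M) auto
      have "cmod (T' (\<lambda>q. \<mu> z q - \<mu> z0 q) q) \<le> symbol_rate * resolvent_bound * (K * cmod (z - z0) * M)"
        using K M by (intro T'_bound diff_meas Lip z) auto
      then show "cmod (T' (\<mu> z) q - T' (\<mu> z0) q)
          \<le> symbol_rate * resolvent_bound * (K * cmod (z - z0) * M)"
        using T'_diff[OF meas[OF z(1)] bdd[OF z(1)] meas[OF z0] bdd[OF z0]] by simp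
    qed
    also have "\<dots> = c * cmod (z - z0)"
      using n0 by (simp add: c_def power2_eq_square field_simps)
    finally show ?thesis .
  qed
  show ?thesis
  proof (rule field_differentiable_if_quotients_Cauchy[OF \<rho>, where C = "\<kappa> * c"])
    show "0 \<le> \<kappa> * c" using \<kappa> c by simp
    fix z z' assume z: "z \<in> N" "z' \<in> N" "z \<noteq> z0" "z' \<noteq> z0" "cmod (z - z0) < \<rho>" "cmod (z' - z0) < \<rho>"
    have "cmod (W z p - W z' p) \<le> \<kappa> * (c * (cmod (z - z0) + cmod (z' - z0)))"
    proof (rule below[of "\<lambda>q. W z q - W z' q"])
      show "strip_measurable (\<lambda>q. W z q - W z' q)" by (intro borel_measurable_diff Wm z)
      show "bounded ((\<lambda>q. W z q - W z' q) ` Strip l)" by (intro bounded_minus_comp Wb z)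
      fix q assume q: "q \<in> Strip l"
      have "(W z q - W z' q) - T (\<lambda>q. W z q - W z' q) q
        = (W z q - T (W z) q - T' (\<mu> z0) q) - (W z' q - T (W z') q - T' (\<mu> z0) q)"
        using resolvent_diff[OF Wm[OF z(1)] Wb[OF z(1)] Wm[OF z(2)] Wb[OF z(2)] S, of q] by simp
      also have "cmod \<dots> \<le> c * cmod (z - z0) + c * cmod (z' - z0)"
        by (intro norm_triangle_le_diff add_mono residual z q)
      finally show "cmod ((W z q - W z' q) - T (\<lambda>q. W z q - W z' q) q)
          \<le> c * (cmod (z - z0) + cmod (z' - z0))"
        by (simp add: distrib_left)
    qed (rule p)
    then show "cmod ((\<mu> z p - \<mu> z0 p) / (z - z0) - (\<mu> z' p - \<mu> z0 p) / (z' - z0))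
        \<le> \<kappa> * c * (cmod (z - z0) + cmod (z' - z0))"
      by (simp add: W_def mult.assoc)
  qed
qed

end

lemma in_Lp_imp_in_L1_L2:
  assumes "in_Lp l 1 u" "in_Lp l 2 u"
  shows "in_L1_L2 l u"
proof -
  have "u \<in> borel_measurable (lebesgue_on (Strip l))" "integrable (lebesgue_on (Strip l)) (\<lambda>q. norm
      (u q))"
    using assms(1) by (simp_all add: in_Lp_def)
  then have "integrable (lebesgue_on (Strip l)) u" by (rule integrable_norm_cancel[rotated])
  moreover have "cmod w powr 2 = (cmod w)\<^sup>2" for w
    by (cases "w = 0") (simp_all add: powr_numeral)
  ultimately show ?thesis using assms(2) by (simp add: in_L1_L2_def in_Lp_def)
qed

theorem theorem2p5:
  fixes l :: real
    and u :: "real \<times> real \<Rightarrow> complex"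
    and \<mu> :: "real \<times> real \<Rightarrow> complex \<Rightarrow> complex"
  assumes "l > 0"
    and "x_periodic l u"
    and "zero_mass l u"
    and "in_Lp l 1 u" and "in_Lp l 2 u"
    and "max (freq l * Lp_norm l 1 u) (sqrt (freq l) * Lp_norm l 2 u) < 2 * pi / C_const l"
    and "is_Jost_function l u \<mu>"
  shows "\<forall>(x, y) \<in> Strip l. (\<lambda>z. \<mu> (x, y) z) holomorphic_on C_freq l"
proof -
  note l = \<open>l > 0\<close>
  have u: "in_L1_L2 l u" by (rule in_Lp_imp_in_L1_L2) fact+
  have sol: "bounded_solution l u z (\<lambda>q. \<mu> q z)" if "z \<in> C_freq l" for z
    using assms(7) that by (simp add: is_Jost_function_def)
  have uniq: "\<nu> = (\<lambda>q. \<mu> q z)" if "z \<in> C_freq l" "bounded_solution l u z \<nu>" for z \<nu>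
    using assms(7) that by (simp add: is_Jost_function_def)
  have "(\<lambda>z. \<mu> p z) field_differentiable (at z0 within C_freq l)" if p: "p \<in> Strip l"
      and z0: "z0 \<in> C_freq l" for p z0
  proof -
    obtain d r where d: "d > 0" and r: "r > 0"
      and gap_near: "\<And>z m \<xi>. cmod (z - z0) \<le> r \<Longrightarrow> m \<noteq> 0 \<Longrightarrow> d * (of_int m)\<^sup>2 \<le> \<bar>Re (P l z m \<xi>)\<bar>"
      using uniform_symbol_gap[OF l z0] by blast
    have gap0: "d * (of_int m)\<^sup>2 \<le> \<bar>Re (P l z0 m \<xi>)\<bar>" if "m \<noteq> 0" for m \<xi>
      using gap_near[of z0] r that by simp
    obtain S where S: "square_bounded S (\<lambda>m \<xi>. 1 / P l z0 m \<xi>)"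
      using inverse_symbol_square_bounded[OF l d gap0] by blast
    interpret regular_parameter l u z0 d S
      by unfold_locales (use l u d gap0 S in auto)
    let ?\<mu> = "\<lambda>q. \<mu> q z0"
    have \<mu>0: "x_periodic l ?\<mu>" "strip_measurable ?\<mu>" "bounded (?\<mu> ` Strip l)" "\<And>p. p \<in> Strip l \<Longrightarrow>
        ?\<mu> p = 1 + T ?\<mu> p"
      using sol[OF z0] by (auto simp: bounded_solution_iff)
    have injective: "\<nu> p = 0" if \<nu>: "strip_measurable \<nu>" "bounded (\<nu> ` Strip l)" "x_periodic l \<nu>"
      "\<And>p. p \<in> Strip l \<Longrightarrow> \<nu> p = T \<nu> p" for \<nu> p
    proof -
      \<comment> \<open>A fixed point of \<open>T\<close> can be subtracted from the solution without leaving the solution set.\<close>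
      have "bounded_solution l u z0 (\<lambda>q. ?\<mu> q - \<nu> q)"
        unfolding bounded_solution_iff
      proof (intro conjI ballI)
        show "x_periodic l (\<lambda>q. ?\<mu> q - \<nu> q)" using \<mu>0(1) \<nu>(3) by (simp add: x_periodic_def)
        show "strip_measurable (\<lambda>q. ?\<mu> q - \<nu> q)" by (intro borel_measurable_diff \<mu>0 \<nu>)
        show "bounded ((\<lambda>q. ?\<mu> q - \<nu> q) ` Strip l)" by (intro bounded_minus_comp \<mu>0 \<nu>)
        fix p assume p: "p \<in> Strip l"
        show "?\<mu> p - \<nu> p = 1 + T (\<lambda>q. ?\<mu> q - \<nu> q) p"
          using \<mu>0(4)[OF p] \<nu>(4)[OF p] resolvent_diff[OF \<mu>0(2,3) \<nu>(1,2) S, of p] by simp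
      qed
      from uniq[OF z0 this] show ?thesis by (metis diff_eq_eq add_cancel_left_right)
    qed
    have "\<exists>\<kappa>>0. bounded_below \<kappa>"
    proof (rule resolvent_bounded_below)
      fix \<nu> p
      assume "strip_measurable \<nu>" "bounded (\<nu> ` Strip l)" "x_periodic l \<nu>" "\<And>p. p \<in> Strip l \<Longrightarrow>
          \<nu> p = T \<nu> p"
      then show "\<nu> p = 0" by (rule injective)
    qed
    then obtain \<kappa> where \<kappa>: "\<kappa> > 0" "bounded_below \<kappa>" by blast
    show ?thesis
      by (rule solution_differentiable[where \<mu> = "\<lambda>z q. \<mu> q z", OF \<kappa> r]) (use gap_near sol z0 p in auto)
  qed
  then show ?thesis by (auto simp: holomorphic_on_def)
qed

end
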